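(* Let $f(t,x)=f^0(X(0,t,x))$ be the $C^4$-solution of $\partial_tf+v\cdot\nabla f=0$ in $[0,T]\times\mathbb{R}^3$, $f(0,\cdot)=f^0$, with $v,f^0$ of class $C^4$ as in the context, and let $g^n$ be the solution of the explicit scheme in the context. Then there is a constant $M>0$, independent of $(h,\tau)$, such that for all sufficiently small $(h,\tau)$ satisfying the scale condition and the CFL-condition of the context, all $0\le n\le T_\tau$ and all $i,j\in\{1,2,3\}$, $$\max_{x\in h\mathbb{Z}^3}|g^n(x)-f(t_n,x)|\le Mh^\alpha,$$ $$\max_{x\in h\mathbb{Z}^3}|D^+_ig^n(x)-\partial_{x_i}f(t_n,x)|\le Mh^\alpha,$$ $$\max_{x\in h\mathbb{Z}^3}|D^-_jD^+_ig^n(x)-\partial_{x_j}\partial_{x_i}f(t_n,x)|\le Mh^\alpha .$$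
   Context: Setting. $T>0$; $\Omega\subset\mathbb{R}^3$ is a bounded connected open set; $v\in C^4([0,T]\times\bar\Omega;\mathbb{R}^3)$ with $\nabla\cdot v=0$ and $\mathrm{supp}(v)\subset[0,T]\times\Omega$; $f^0\in C^4(\bar\Omega;\mathbb{R})$ with $f^0\equiv0$ in a neighborhood of $\partial\Omega$. $v$ and $f^0$ are extended by $0$ to $x\in\mathbb{R}^3\setminus\Omega$ (the extensions are $C^4$ and denoted by the same symbols). $X(s,t,\xi)$ is the flow: $s\mapsto X(s,t,\xi)$ solves $x'(s)=v(s,x(s))$, $x(t)=\xi$. Grid. $h,\tau>0$ are the space and time mesh sizes; $t_n=n\tau$; $T_\tau\in\mathbb{N}$ is such that $T\in[\tau T_\tau,\tau T_\tau+\tau)$. $e^1,e^2,e^3$ is the standard basis of $\mathbb{R}^3$; $B=\{\pm e^1,\pm e^2,\pm e^3,0\}$; $C_h(x)=\prod_{i=1}^3[x_i-\frac h2,x_i+\frac h2)$. $D^+_i\phi(x)=\frac{\phi(x+he^i)-\phi(x)}h$, $D^-_i\phi(x)=\frac{\phi(x)-\phi(x-he^i)}h$, $D_i\phi(x)=\frac{\phi(x+he^i)-\phi(x-he^i)}{2h}$. Scale condition: $0<\alpha\le1$ is fixed and $\tau$ is of order $h^{2-\alpha}$, i.e. $c\,h^{2-\alpha}\le\tau\le C\,h^{2-\alpha}$ with fixed constants $0<c\le C$. Explicit scheme. $g^0(x)=\frac1{h^3}\int_{C_h(x)}f^0(y)\,dy$, $u^n_i(x)=\frac1{\tau h^3}\int_{\tau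 n}^{\tau(n+1)}\int_{C_h(x)}v_i(s,y)\,dy\,ds$ for $x\in h\mathbb{Z}^3$, and for $0\le n\le T_\tau-1$, $x\in h\mathbb{Z}^3$, $$\Big(g^{n+1}(x)-\frac17\sum_{\omega\in B}g^n(x+h\omega)\Big)\frac1\tau+\sum_{j=1}^3u^n_j(x)D_jg^n(x)=0 .$$ CFL-condition: $\frac17\pm\frac\tau{2h}u^n_j(x)\ge0$ for all $n,j,x$. *)

theory Defs
  imports "HOL-Analysis.Analysis"
begin

text \<open>The class C^k on the closure of an open set U: all partial derivatives up to order k exist
  in U and extend continuously to the closure of U.\<close>

primrec Ck_closure ::
  "nat \<Rightarrow> 'a::euclidean_space set \<Rightarrow> ('a \<Rightarrow> 'b::real_normed_vector) \<Rightarrow> bool" where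
  "Ck_closure 0 U \<phi> \<longleftrightarrow> continuous_on (closure U) \<phi>"
| "Ck_closure (Suc k) U \<phi> \<longleftrightarrow> continuous_on (closure U) \<phi> \<and>
     (\<forall>b\<in>Basis. \<exists>\<psi>. Ck_closure k U \<psi> \<and>
        (\<forall>z\<in>U. ((\<lambda>s. \<phi> (z + s *\<^sub>R b)) has_vector_derivative \<psi> z) (at 0)))"

definition partial_deriv :: "3 \<Rightarrow> (real^3 \<Rightarrow> real) \<Rightarrow> real^3 \<Rightarrow> real" where
  "partial_deriv i \<phi> x = deriv (\<lambda>s. \<phi> (x + s *\<^sub>R axis i 1)) 0"

definition divergence :: "(real^3 \<Rightarrow> real^3) \<Rightarrow> real^3 \<Rightarrow> real" where
  "divergence w x = (\<Sum>i\<in>UNIV. partial_deriv i (\<lambda>y. w y $ i) x)"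

definition extend_zero :: "'a set \<Rightarrow> ('a \<Rightarrow> 'b::zero) \<Rightarrow> 'a \<Rightarrow> 'b" where
  "extend_zero \<Omega> \<phi> x = (if x \<in> \<Omega> then \<phi> x else 0)"

definition admissible_velocity :: "real \<Rightarrow> (real^3) set \<Rightarrow> (real \<Rightarrow> real^3 \<Rightarrow> real^3) \<Rightarrow> bool" where
  "admissible_velocity T \<Omega> v \<longleftrightarrow>
     Ck_closure 4 ({0<..<T} \<times> \<Omega>) (\<lambda>(t, x). v t x) \<and>
     (\<forall>t\<in>{0..T}. \<forall>x\<in>\<Omega>. divergence (v t) x = 0) \<and>
     closure {(t, x). t \<in> {0..T} \<and> x \<in> closure \<Omega> \<and> v t x \<noteq> 0} \<subseteq> {0..T} \<times> \<Omega>"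

definition admissible_initial :: "(real^3) set \<Rightarrow> (real^3 \<Rightarrow> real) \<Rightarrow> bool" where
  "admissible_initial \<Omega> f0 \<longleftrightarrow>
     Ck_closure 4 \<Omega> f0 \<and>
     (\<exists>N. open N \<and> frontier \<Omega> \<subseteq> N \<and> (\<forall>x \<in> N \<inter> closure \<Omega>. f0 x = 0))"

definition is_flow ::
  "real \<Rightarrow> (real \<Rightarrow> real^3 \<Rightarrow> real^3) \<Rightarrow> (real \<Rightarrow> real \<Rightarrow> real^3 \<Rightarrow> real^3) \<Rightarrow> bool" where
  "is_flow T v X \<longleftrightarrow>
     (\<forall>t\<in>{0..T}. \<forall>\<xi>. X t t \<xi> = \<xi> \<and>
        (\<forall>s\<in>{0..T}. ((\<lambda>r. X r t \<xi>) has_vector_derivative v s (X s t \<xi>)) (at s within {0..T})))"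

definition grid :: "real \<Rightarrow> (real^3) set" where
  "grid h = {x. \<forall>i. \<exists>k::int. x $ i = h * of_int k}"

definition stencil :: "(real^3) set" where
  "stencil = insert 0 (range (\<lambda>i. axis i 1) \<union> range (\<lambda>i. - axis i 1))"

definition cell :: "real \<Rightarrow> real^3 \<Rightarrow> (real^3) set" where
  "cell h x = {y. \<forall>i. x $ i - h / 2 \<le> y $ i \<and> y $ i < x $ i + h / 2}"

definition fwd_diff :: "real \<Rightarrow> 3 \<Rightarrow> (real^3 \<Rightarrow> real) \<Rightarrow> real^3 \<Rightarrow> real" where
  "fwd_diff h i \<phi> x = (\<phi> (x + h *\<^sub>R axis i 1) - \<phi> x) / h"

definition bwd_diff :: "real \<Rightarrow> 3 \<Rightarrow> (real^3 \<Rightarrow> real) \<Rightarrow> real^3 \<Rightarrow> real" where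
  "bwd_diff h i \<phi> x = (\<phi> x - \<phi> (x - h *\<^sub>R axis i 1)) / h"

definition central_diff :: "real \<Rightarrow> 3 \<Rightarrow> (real^3 \<Rightarrow> real) \<Rightarrow> real^3 \<Rightarrow> real" where
  "central_diff h i \<phi> x = (\<phi> (x + h *\<^sub>R axis i 1) - \<phi> (x - h *\<^sub>R axis i 1)) / (2 * h)"

definition initial_avg :: "real \<Rightarrow> (real^3 \<Rightarrow> real) \<Rightarrow> real^3 \<Rightarrow> real" where
  "initial_avg h f0 x = 1 / h ^ 3 * integral (cell h x) f0"

definition velocity_avg ::
  "real \<Rightarrow> real \<Rightarrow> (real \<Rightarrow> real^3 \<Rightarrow> real^3) \<Rightarrow> nat \<Rightarrow> 3 \<Rightarrow> real^3 \<Rightarrow> real" where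
  "velocity_avg h \<tau> v n i x =
     1 / (\<tau> * h ^ 3) *
       integral {\<tau> * real n..\<tau> * real (n + 1)} (\<lambda>s. integral (cell h x) (\<lambda>y. v s y $ i))"

text \<open>N is the number of time steps. Only the values of g at times 0,...,N and at the
  grid points are constrained.\<close>

definition explicit_scheme ::
  "real \<Rightarrow> real \<Rightarrow> nat \<Rightarrow> (real \<Rightarrow> real^3 \<Rightarrow> real^3) \<Rightarrow> (real^3 \<Rightarrow> real)
    \<Rightarrow> (nat \<Rightarrow> real^3 \<Rightarrow> real) \<Rightarrow> bool" where
  "explicit_scheme h \<tau> N v f0 g \<longleftrightarrow>
     (\<forall>x\<in>grid h. g 0 x = initial_avg h f0 x) \<and>
     (\<forall>n<N. \<forall>x\<in>grid h.
        (g (n + 1) x - 1 / 7 * (\<Sum>\<omega>\<in>stencil. g n (x + h *\<^sub>R \<omega>))) * (1 / \<tau>)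
          + (\<Sum>j\<in>UNIV. velocity_avg h \<tau> v n j x * central_diff h j (g n) x) = 0)"

definition CFL :: "real \<Rightarrow> real \<Rightarrow> nat \<Rightarrow> (real \<Rightarrow> real^3 \<Rightarrow> real^3) \<Rightarrow> bool" where
  "CFL h \<tau> N v \<longleftrightarrow>
     (\<forall>n<N. \<forall>j. \<forall>x\<in>grid h.
        1 / 7 + \<tau> / (2 * h) * velocity_avg h \<tau> v n j x \<ge> 0 \<and>
        1 / 7 - \<tau> / (2 * h) * velocity_avg h \<tau> v n j x \<ge> 0)"

end

(*
Iterated finite differences are controlled throughout by predicates that behave like C^k bounds but
make sense for merely bounded functions and on lattices alike.  Under the CFL condition one step of
the scheme is a convex combination of shifts, and differencing it k times reproduces it up to O(tau)
terms of order at most k; hence iterated differences of discrete solutions grow at most like exp(C t).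

Applied on the whole space with h proportional to tau and time-averaged velocities, this yields
discrete solutions with uniformly bounded fourth differences which converge pointwise to
f(t, x) = f0(X(0, t, x)), since f is constant along the (merely Lipschitz) flow.  So f(t, .) has bounded
fourth differences, without any differentiability of the flow, and therefore satisfies
f(t) - f(s) = - integral of v . grad f.  Consequently the residual of f in the given scheme is
O(tau (tau + h) + h^2) together with its first and second differences, and the stability estimate on the
grid bounds g - f and its first and second difference quotients by O(tau + h + h^2 / tau) = O(h^alpha).
*)

theory Submission
  imports Defs
begin

subsection \<open>Functions with bounded iterated differences\<close>

text \<open>The obstacle is that nothing is known about \<open>X 0 t x\<close> as a function of
  \<open>x\<close> beyond what the equation gives, so \<open>f\<close> cannot be put into a
  consistency estimate at the start. In the first pass the roles are exchanged: the discrete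
  solution, whose differences are bounded by stability alone, is the regular function that gets
  Taylor expanded, and \<open>f\<close> enters only through its constancy along characteristics. The
  mesh is proportional to \<open>\<tau>\<close> there because each step carries a numerical
  diffusion of size \<open>h\<^sup>2\<close>, which must be of order \<open>\<tau>\<^sup>2\<close>
  to vanish after summation. With the given meshes the same diffusion is the term
  \<open>h\<^sup>2 / \<tau>\<close>, which limits the rate to \<open>h powr \<alpha>\<close>.
  Stability closes at every order because differencing the transport term moves one difference onto
  the velocity, so the commutator contains no more differences of the solution than are being
  estimated. Order four is spent as two plus two: the error is measured in second differences, and
  replacing a difference quotient by a derivative costs two orders.\<close>

definition sdiff :: "'a::real_vector \<Rightarrow> ('a \<Rightarrow> real) \<Rightarrow> 'a \<Rightarrow> real" where
  "sdiff w \<phi> x = \<phi> (x + w) - \<phi> x"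

text \<open>For \<open>A = W = UNIV\<close> this is a bound by \<open>K\<close> in the class \<open>C\<^bsup>k-1,1\<^esup>\<close>; for a lattice \<open>A\<close> it is a
  bound on all difference quotients up to order \<open>k\<close> with increments in \<open>W\<close>.\<close>

primrec dbound ::
  "'a set \<Rightarrow> 'a set \<Rightarrow> nat \<Rightarrow> real \<Rightarrow> ('a::real_normed_vector \<Rightarrow> real) \<Rightarrow> bool" where
  "dbound A W 0 K \<phi> \<longleftrightarrow> (\<forall>x\<in>A. \<bar>\<phi> x\<bar> \<le> K)"
| "dbound A W (Suc k) K \<phi> \<longleftrightarrow>
     (\<forall>x\<in>A. \<bar>\<phi> x\<bar> \<le> K) \<and> (\<forall>w\<in>W. dbound A W k (K * norm w) (sdiff w \<phi>))"

abbreviation ubound :: "nat \<Rightarrow> real \<Rightarrow> ('a::real_normed_vector \<Rightarrow> real) \<Rightarrow> bool" where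
  "ubound \<equiv> dbound UNIV UNIV"

definition shift_closed :: "'a::real_vector set \<Rightarrow> 'a set \<Rightarrow> bool" where
  "shift_closed A W \<longleftrightarrow> (\<forall>x\<in>A. \<forall>w\<in>W. x + w \<in> A)"

lemma shift_closed_UNIV [simp]: "shift_closed UNIV W"
  by (simp add: shift_closed_def)

lemma shift_closedD: "shift_closed A W \<Longrightarrow> x \<in> A \<Longrightarrow> w \<in> W \<Longrightarrow> x + w \<in> A"
  by (simp add: shift_closed_def)

lemma dbound_bound: "dbound A W k K \<phi> \<Longrightarrow> x \<in> A \<Longrightarrow> \<bar>\<phi> x\<bar> \<le> K"
  by (cases k) auto

lemma dbound_sdiff: "dbound A W (Suc k) K \<phi> \<Longrightarrow> w \<in> W \<Longrightarrow> dbound A W k (K * norm w) (sdiff w \<phi>)"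
  by simp

lemma dbound_mono: "dbound A W k K \<phi> \<Longrightarrow> K \<le> K' \<Longrightarrow> dbound A W k K' \<phi>"
proof (induction k arbitrary: K K' \<phi>)
  case (Suc k)
  have "dbound A W k (K' * norm w) (sdiff w \<phi>)" if "w \<in> W" for w
    using dbound_sdiff[OF Suc.prems(1) that] mult_right_mono[OF Suc.prems(2) norm_ge_zero]
    by (rule Suc.IH)
  with Suc.prems show ?case by fastforce
qed fastforce

lemma dbound_Suc_imp: "dbound A W (Suc k) K \<phi> \<Longrightarrow> dbound A W k K \<phi>"
proof (induction k arbitrary: K \<phi>)
  case (Suc k)
  show ?case
    unfolding dbound.simps(2)[of _ _ k]
  proof (intro conjI ballI)
    show "\<bar>\<phi> x\<bar> \<le> K" if "x \<in> A" for x using Suc.prems that by simp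
    fix w assume "w \<in> W"
    then show "dbound A W k (K * norm w) (sdiff w \<phi>)"
      using Suc.IH Suc.prems dbound_sdiff by blast
  qed
qed auto

lemma dbound_le: "dbound A W k K \<phi> \<Longrightarrow> j \<le> k \<Longrightarrow> dbound A W j K \<phi>"
  by (induction k) (auto simp: le_Suc_eq simp del: dbound.simps dest: dbound_Suc_imp)

lemma sdiff_cong_on:
  assumes "shift_closed A W" "\<And>x. x \<in> A \<Longrightarrow> \<phi> x = \<psi> x" "w \<in> W" "x \<in> A"
  shows "sdiff w \<phi> x = sdiff w \<psi> x"
  using assms by (simp add: sdiff_def shift_closed_def)

text \<open>Invariance of \<open>A\<close> keeps every point probed by an iterated difference inside
  \<open>A\<close>. This matters for discrete solutions, whose values off the grid are
  arbitrary.\<close>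

lemma dbound_cong:
  assumes "shift_closed A W" "dbound A W k K \<phi>" "\<And>x. x \<in> A \<Longrightarrow> \<phi> x = \<psi> x"
  shows "dbound A W k K \<psi>"
  using assms(2,3)
proof (induction k arbitrary: K \<phi> \<psi>)
  case (Suc k)
  have "dbound A W k (K * norm w) (sdiff w \<psi>)" if "w \<in> W" for w
    using dbound_sdiff[OF Suc.prems(1) that] sdiff_cong_on[OF assms(1) Suc.prems(2) that]
    by (rule Suc.IH)
  moreover have "\<bar>\<psi> x\<bar> \<le> K" if "x \<in> A" for x
    using dbound_bound[OF Suc.prems(1) that] Suc.prems(2)[OF that] by simp
  ultimately show ?case by simp
qed simp

lemma dbound_subset:
  "dbound A W k K \<phi> \<Longrightarrow> A' \<subseteq> A \<Longrightarrow> W' \<subseteq> W \<Longrightarrow> dbound A' W' k K \<phi>"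
  by (induction k arbitrary: K \<phi>) auto

lemma dbound_add:
  "dbound A W k K \<phi> \<Longrightarrow> dbound A W k L \<psi> \<Longrightarrow> dbound A W k (K + L) (\<lambda>x. \<phi> x + \<psi> x)"
proof (induction k arbitrary: K L \<phi> \<psi>)
  case 0
  then show ?case by (auto intro!: order_trans[OF abs_triangle_ineq] add_mono)
next
  case (Suc k)
  have "sdiff w (\<lambda>x. \<phi> x + \<psi> x) = (\<lambda>x. sdiff w \<phi> x + sdiff w \<psi> x)" for w
    by (auto simp: sdiff_def)
  with Suc show ?case
    by (auto simp: distrib_right intro!: order_trans[OF abs_triangle_ineq] add_mono)
qed

lemma dbound_cmult: "dbound A W k K \<phi> \<Longrightarrow> dbound A W k (\<bar>a\<bar> * K) (\<lambda>x. a * \<phi> x)"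
proof (induction k arbitrary: K \<phi>)
  case 0
  then show ?case by (auto simp: abs_mult intro!: mult_left_mono)
next
  case (Suc k)
  have "sdiff w (\<lambda>x. a * \<phi> x) = (\<lambda>x. a * sdiff w \<phi> x)" for w
    by (auto simp: sdiff_def algebra_simps)
  with Suc show ?case by (auto simp: abs_mult mult.assoc intro!: mult_left_mono)
qed

lemma dbound_minus: "dbound A W k K \<phi> \<Longrightarrow> dbound A W k K (\<lambda>x. - \<phi> x)"
  using dbound_cmult[of A W k K \<phi> "-1"] by simp

lemma dbound_diff:
  "dbound A W k K \<phi> \<Longrightarrow> dbound A W k L \<psi> \<Longrightarrow> dbound A W k (K + L) (\<lambda>x. \<phi> x - \<psi> x)"
  using dbound_add[of A W k K \<phi> L "\<lambda>x. - \<psi> x"] dbound_minus[of A W k L \<psi>] by simp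

lemma dbound_zero: "dbound A W k 0 (\<lambda>x. 0)"
  by (induction k) (auto simp: sdiff_def[abs_def])

lemma dbound_sum:
  assumes "finite I" "\<And>i. i \<in> I \<Longrightarrow> dbound A W k (K i) (\<phi> i)"
  shows "dbound A W k (\<Sum>i\<in>I. K i) (\<lambda>x. \<Sum>i\<in>I. \<phi> i x)"
  using assms by (induction I) (auto simp: dbound_zero intro!: dbound_add)

lemma dbound_shift:
  assumes "\<And>x. x \<in> A \<Longrightarrow> x + y \<in> A" "dbound A W k K \<phi>"
  shows "dbound A W k K (\<lambda>x. \<phi> (x + y))"
  using assms(2)
proof (induction k arbitrary: K \<phi>)
  case (Suc k)
  have "sdiff w (\<lambda>x. \<phi> (x + y)) = (\<lambda>x. sdiff w \<phi> (x + y))" for w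
    by (auto simp: sdiff_def algebra_simps)
  with Suc assms(1) show ?case by auto
qed (use assms(1) in auto)

text \<open>Discrete Leibniz rule: each difference splits the product into two terms of the same
  kind, which doubles the constant.\<close>

lemma dbound_mult:
  assumes "shift_closed A W" "dbound A W k K \<phi>" "dbound A W k L \<psi>" "0 \<le> K" "0 \<le> L"
  shows "dbound A W k (2 ^ k * K * L) (\<lambda>x. \<phi> x * \<psi> x)"
  using assms(2-)
proof (induction k arbitrary: K L \<phi> \<psi>)
  case 0
  then show ?case by (auto simp: abs_mult intro!: mult_mono)
next
  case (Suc k)
  have "\<bar>\<phi> x * \<psi> x\<bar> \<le> 2 ^ Suc k * K * L" if "x \<in> A" for x
  proof -
    have "\<bar>\<phi> x * \<psi> x\<bar> \<le> 1 * (K * L)"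
      using Suc.prems that by (auto simp: abs_mult intro!: mult_mono)
    also have "\<dots> \<le> 2 ^ Suc k * (K * L)"
      using Suc.prems by (intro mult_right_mono) (auto intro: one_le_power simp del: power_Suc)
    finally show ?thesis by (simp add: mult.assoc)
  qed
  moreover have "dbound A W k (2 ^ Suc k * K * L * norm w) (sdiff w (\<lambda>x. \<phi> x * \<psi> x))" if w: "w \<in> W" for w
  proof -
    have eq: "sdiff w (\<lambda>x. \<phi> x * \<psi> x) = (\<lambda>x. \<phi> (x + w) * sdiff w \<psi> x + sdiff w \<phi> x * \<psi> x)"
      by (auto simp: sdiff_def algebra_simps)
    have "dbound A W k (2 ^ k * K * (L * norm w)) (\<lambda>x. \<phi> (x + w) * sdiff w \<psi> x)"
      using Suc.prems w assms(1)
      by (intro Suc.IH dbound_shift dbound_Suc_imp[OF Suc.prems(1)]) (auto simp: shift_closed_def)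
    moreover have "dbound A W k (2 ^ k * (K * norm w) * L) (\<lambda>x. sdiff w \<phi> x * \<psi> x)"
      using Suc.prems w by (intro Suc.IH dbound_Suc_imp[OF Suc.prems(2)]) auto
    ultimately show ?thesis
      unfolding eq by (rule dbound_mono[OF dbound_add]) (simp add: algebra_simps)
  qed
  ultimately show ?case by simp
qed

text \<open>Each condition in \<open>dbound\<close> is a closed condition on finitely many point
  values, so pointwise convergence is enough. This is how regularity passes from discrete solutions
  to \<open>f\<close>.\<close>

lemma dbound_LIMSEQ:
  assumes "\<And>n. dbound A W k K (\<phi> n)" "\<And>x. (\<lambda>n. \<phi> n x) \<longlonglongrightarrow> \<psi> x"
  shows "dbound A W k K \<psi>"
  using assms
proof (induction k arbitrary: K \<phi> \<psi>)
  case 0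
  have "\<bar>\<psi> x\<bar> \<le> K" if "x \<in> A" for x
    using Lim_bounded[OF tendsto_rabs[OF 0(2)]] 0(1) that by auto
  then show ?case by simp
next
  case (Suc k)
  have "\<bar>\<psi> x\<bar> \<le> K" if "x \<in> A" for x
    using Lim_bounded[OF tendsto_rabs[OF Suc.prems(2)]] Suc.prems(1) that by auto
  moreover have "dbound A W k (K * norm w) (sdiff w \<psi>)" if "w \<in> W" for w
  proof (rule Suc.IH)
    show "dbound A W k (K * norm w) (sdiff w (\<phi> n))" for n
      using dbound_sdiff[OF Suc.prems(1) that] .
    show "(\<lambda>n. sdiff w (\<phi> n) x) \<longlonglongrightarrow> sdiff w \<psi> x" for x
      unfolding sdiff_def by (intro tendsto_diff Suc.prems(2))
  qed
  ultimately show ?case by simp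
qed

lemma dbound_integral:
  fixes \<phi> :: "'b::euclidean_space \<Rightarrow> 'a::real_normed_vector \<Rightarrow> real"
  assumes "\<And>s. s \<in> cbox a b \<Longrightarrow> dbound UNIV W k K (\<phi> s)"
    and "\<And>x. (\<lambda>s. \<phi> s x) integrable_on cbox a b" and "0 \<le> K"
  shows "dbound UNIV W k (K * measure lborel (cbox a b)) (\<lambda>x. integral (cbox a b) (\<lambda>s. \<phi> s x))"
  using assms
proof (induction k arbitrary: K \<phi>)
  case 0
  then show ?case
    using has_integral_bound[OF 0(3) integrable_integral[OF 0(2)]] by auto
next
  case (Suc k)
  have "\<bar>integral (cbox a b) (\<lambda>s. \<phi> s x)\<bar> \<le> K * measure lborel (cbox a b)" for x
    using has_integral_bound[OF Suc.prems(3) integrable_integral[OF Suc.prems(2)]]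
      Suc.prems(1) by auto
  moreover have "dbound UNIV W k (K * measure lborel (cbox a b) * norm w)
      (sdiff w (\<lambda>x. integral (cbox a b) (\<lambda>s. \<phi> s x)))" if "w \<in> W" for w
  proof -
    have eq: "sdiff w (\<lambda>x. integral (cbox a b) (\<lambda>s. \<phi> s x)) =
        (\<lambda>x. integral (cbox a b) (\<lambda>s. sdiff w (\<phi> s) x))"
      by (auto simp: sdiff_def integral_diff[OF Suc.prems(2) Suc.prems(2)])
    have "dbound UNIV W k (K * norm w * measure lborel (cbox a b)) (\<lambda>x. integral (cbox a b) (\<lambda>s. sdiff w (\<phi> s) x))"
    proof (rule Suc.IH)
      show "dbound UNIV W k (K * norm w) (sdiff w (\<phi> s))" if "s \<in> cbox a b" for s
        using dbound_sdiff[OF Suc.prems(1)[OF that] \<open>w \<in> W\<close>] .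
      show "(\<lambda>s. sdiff w (\<phi> s) x) integrable_on cbox a b" for x
        unfolding sdiff_def by (intro integrable_diff Suc.prems(2))
    qed (use Suc.prems(3) in simp)
    then show ?thesis unfolding eq by (simp add: mult_ac)
  qed
  ultimately show ?case by simp
qed

lemma ubound_Lipschitz:
  assumes "ubound (Suc k) K \<phi>" shows "\<bar>\<phi> y - \<phi> x\<bar> \<le> K * norm (y - x)"
  using dbound_bound[OF dbound_sdiff[OF assms, of "y - x"], of x] by (simp add: sdiff_def)

lemma ubound_continuous:
  assumes "ubound (Suc k) K \<phi>" shows "continuous_on S \<phi>"
proof -
  have "0 \<le> K" using dbound_bound[OF assms, of 0] by simp
  then have "K-lipschitz_on S \<phi>"
    using ubound_Lipschitz[OF assms] by (intro lipschitz_onI) (auto simp: dist_norm)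
  then show ?thesis by (rule lipschitz_on_continuous_on)
qed

lemma dbound_nonneg: "dbound A W k K \<phi> \<Longrightarrow> A \<noteq> {} \<Longrightarrow> 0 \<le> K"
  using dbound_bound[of A W k K \<phi>] by (meson abs_ge_zero all_not_in_conv order_trans)

subsection \<open>The one-step operator of the scheme\<close>

definition step ::
  "real \<Rightarrow> real \<Rightarrow> (3 \<Rightarrow> real^3 \<Rightarrow> real) \<Rightarrow> (real^3 \<Rightarrow> real) \<Rightarrow> real^3 \<Rightarrow> real" where
  "step h \<tau> u G x = 1 / 7 * (\<Sum>\<omega>\<in>stencil. G (x + h *\<^sub>R \<omega>)) - \<tau> * (\<Sum>j\<in>UNIV. u j x * central_diff h j G x)"

definition grid_steps :: "real \<Rightarrow> (real^3) set" where
  "grid_steps h = {w. \<exists>j. w = h *\<^sub>R axis j 1 \<or> w = - (h *\<^sub>R axis j 1)}"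

lemma sum_stencil:
  "(\<Sum>\<omega>\<in>stencil. G (x + h *\<^sub>R \<omega>)) =
    G x + (\<Sum>j\<in>UNIV. G (x + h *\<^sub>R axis j 1) + G (x - h *\<^sub>R axis j (1::real)) :: real)"
proof -
  let ?P = "range (\<lambda>i. axis i (1::real)) :: (real^3) set"
  let ?N = "range (\<lambda>i. - axis i (1::real)) :: (real^3) set"
  have inj: "inj (\<lambda>i. axis i (1::real) :: real^3)" "inj (\<lambda>i. - axis i (1::real) :: real^3)"
    by (auto simp: inj_on_def axis_eq_axis)
  have "axis i (1::real) \<noteq> - axis j 1" for i j :: 3
  proof
    assume "axis i (1::real) = - axis j 1"
    then have "axis i (1::real) $ i = (- axis j 1) $ i" by simp
    then show False by (simp add: axis_def split: if_splits)
  qed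
  then have disj: "?P \<inter> ?N = {}" by auto
  have zero: "0 \<notin> ?P \<union> ?N" by (auto simp: axis_eq_0_iff)
  have "(\<Sum>\<omega>\<in>stencil. G (x + h *\<^sub>R \<omega>)) = G x + (\<Sum>\<omega>\<in>?P. G (x + h *\<^sub>R \<omega>)) + (\<Sum>\<omega>\<in>?N. G (x + h *\<^sub>R \<omega>))"
    unfolding stencil_def using zero disj by (simp add: sum.union_disjoint)
  also have "\<dots> = G x + (\<Sum>j\<in>UNIV. G (x + h *\<^sub>R axis j 1)) + (\<Sum>j\<in>UNIV. G (x - h *\<^sub>R axis j 1))"
    using inj by (simp add: sum.reindex)
  finally show ?thesis by (simp add: sum.distrib)
qed

text \<open>As a weighted sum of point values: the weights add up to 1, and the CFL condition says
  that they are nonnegative.\<close>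

lemma step_eq:
  "step h \<tau> u G x = 1 / 7 * G x + (\<Sum>j\<in>UNIV. (1 / 7 - \<tau> / (2 * h) * u j x) * G (x + h *\<^sub>R axis j 1)
     + (1 / 7 + \<tau> / (2 * h) * u j x) * G (x - h *\<^sub>R axis j 1))"
  unfolding step_def sum_stencil central_diff_def
  by (simp add: sum_distrib_left sum_subtractf sum.distrib algebra_simps diff_divide_distrib add_divide_distrib)

lemma step_diff: "step h \<tau> u G x - step h \<tau> u F x = step h \<tau> u (\<lambda>y. G y - F y) x"
  unfolding step_eq by (simp add: algebra_simps sum.distrib sum_subtractf diff_divide_distrib)

text \<open>The last term is the commutator of differencing and stepping. It takes one more
  difference of \<open>G\<close> through \<open>central_diff\<close>, but \<open>w\<close> then
  falls on the velocity, so the number of differences of \<open>G\<close> does not grow.\<close>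

lemma sdiff_step:
  "sdiff w (step h \<tau> u G) = (\<lambda>x. step h \<tau> u (sdiff w G) x -
     \<tau> * (\<Sum>j\<in>UNIV. sdiff w (u j) x * central_diff h j G (x + w)))"
  unfolding sdiff_def step_def central_diff_def
  by (rule ext) (simp add: algebra_simps sum.distrib sum_subtractf diff_divide_distrib add_divide_distrib)

lemma central_diff_eq_sdiff:
  "central_diff h j G = (\<lambda>x. 1 / (2 * h) * (sdiff (h *\<^sub>R axis j 1) G x - sdiff (- (h *\<^sub>R axis j 1)) G x))"
  by (auto simp: central_diff_def sdiff_def)

lemma dbound_central_diff:
  assumes "dbound A W (Suc k) K G" "grid_steps h \<subseteq> W" "0 < h"
  shows "dbound A W k K (central_diff h j G)"
proof -
  have "h *\<^sub>R axis j 1 \<in> W" "- (h *\<^sub>R axis j 1) \<in> W"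
    using assms(2) by (auto simp: grid_steps_def)
  from dbound_sdiff[OF assms(1) this(1)] dbound_sdiff[OF assms(1) this(2)]
  have "dbound A W k (\<bar>1 / (2 * h)\<bar> * (K * h + K * h)) (central_diff h j G)"
    unfolding central_diff_eq_sdiff using assms(3) by (intro dbound_cmult dbound_diff) auto
  with assms(3) show ?thesis by (simp add: field_simps)
qed

lemma step_max_principle:
  assumes "\<And>j. 1 / 7 + \<tau> / (2 * h) * u j x \<ge> 0" "\<And>j. 1 / 7 - \<tau> / (2 * h) * u j x \<ge> 0"
    and "\<bar>G x\<bar> \<le> K" "\<And>j. \<bar>G (x + h *\<^sub>R axis j 1)\<bar> \<le> K" "\<And>j. \<bar>G (x - h *\<^sub>R axis j 1)\<bar> \<le> K"
  shows "\<bar>step h \<tau> u G x\<bar> \<le> K"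
proof -
  have "\<bar>(1 / 7 - \<tau> / (2 * h) * u j x) * G (x + h *\<^sub>R axis j 1)
     + (1 / 7 + \<tau> / (2 * h) * u j x) * G (x - h *\<^sub>R axis j 1)\<bar>
     \<le> (1 / 7 - \<tau> / (2 * h) * u j x) * K + (1 / 7 + \<tau> / (2 * h) * u j x) * K" for j
    using assms by (intro order_trans[OF abs_triangle_ineq] add_mono) (auto simp only: abs_mult abs_of_nonneg intro!: mult_left_mono)
  moreover have "(1 / 7 - \<tau> / (2 * h) * u j x) * K + (1 / 7 + \<tau> / (2 * h) * u j x) * K = 2 / 7 * K" for j
    by (simp add: algebra_simps)
  ultimately have "\<bar>(1 / 7 - \<tau> / (2 * h) * u j x) * G (x + h *\<^sub>R axis j 1)
     + (1 / 7 + \<tau> / (2 * h) * u j x) * G (x - h *\<^sub>R axis j 1)\<bar> \<le> 2 / 7 * K" for j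
    by metis
  from sum_mono[of UNIV, OF this] have
    "\<bar>\<Sum>j\<in>UNIV. (1 / 7 - \<tau> / (2 * h) * u j x) * G (x + h *\<^sub>R axis j 1)
     + (1 / 7 + \<tau> / (2 * h) * u j x) * G (x - h *\<^sub>R axis j 1)\<bar> \<le> (\<Sum>j\<in>(UNIV::3 set). 2 / 7 * K)"
    by (rule order_trans[OF sum_abs])
  then show ?thesis unfolding step_eq using assms(3) by simp
qed

text \<open>Differencing the scheme reproduces it up to lower-order terms of size \<open>\<tau>\<close>, so each bound
  grows by a factor \<open>1 + O(\<tau>)\<close> per step.\<close>

lemma dbound_step:
  assumes "shift_closed A W" "grid_steps h \<subseteq> W" "0 < h" "0 \<le> \<tau>"
    and "\<And>x j. x \<in> A \<Longrightarrow> 1 / 7 + \<tau> / (2 * h) * u j x \<ge> 0"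
    and "\<And>x j. x \<in> A \<Longrightarrow> 1 / 7 - \<tau> / (2 * h) * u j x \<ge> 0"
    and "0 \<le> V" "\<And>j. dbound A W k V (u j)" "0 \<le> K" "dbound A W k K G"
  shows "dbound A W k (K * (1 + 3 * 2 ^ k * V * \<tau>)) (step h \<tau> u G)"
proof -
  have st: "h *\<^sub>R axis j 1 \<in> W" "- (h *\<^sub>R axis j 1) \<in> W" for j
    using assms(2) by (auto simp: grid_steps_def)
  have max: "\<bar>step h \<tau> u G x\<bar> \<le> K * (1 + 3 * 2 ^ k * V * \<tau>)"
    if "dbound A W k K G" "0 \<le> K" "x \<in> A" for k K G x
  proof -
    have "\<bar>step h \<tau> u G x\<bar> \<le> K"
      using shift_closedD[OF assms(1) that(3) st(1)] shift_closedD[OF assms(1) that(3) st(2)]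
        dbound_bound[OF that(1)] that(3) assms(5,6) by (intro step_max_principle) auto
    also have "\<dots> \<le> K * (1 + 3 * 2 ^ k * V * \<tau>)"
      using that(2) assms(4,7) by (simp add: algebra_simps)
    finally show ?thesis .
  qed
  show ?thesis
    using assms(8-)
  proof (induction k arbitrary: K G)
    case 0
    then show ?case using max[of 0 K G] by simp
  next
    case (Suc k)
    \<comment> \<open>The commutator contributes 3 * 2^k (three directions, Leibniz factor 2^k) and
      the induction hypothesis another 3 * 2^k, hence the doubling with each order.\<close>
    have "dbound A W k (K * (1 + 3 * 2 ^ Suc k * V * \<tau>) * norm w) (sdiff w (step h \<tau> u G))"
      if w: "w \<in> W" for w
    proof -
      have "dbound A W k (2 ^ k * (V * norm w) * K) (\<lambda>x. sdiff w (u j) x * central_diff h j G (x + w))" for j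
        using Suc.prems assms w
        by (intro dbound_mult dbound_sdiff dbound_shift dbound_central_diff) (auto simp: shift_closed_def)
      then have "dbound A W k (\<Sum>j\<in>(UNIV::3 set). 2 ^ k * (V * norm w) * K)
          (\<lambda>x. \<Sum>j\<in>UNIV. sdiff w (u j) x * central_diff h j G (x + w))"
        by (intro dbound_sum) auto
      then have "dbound A W k (\<bar>\<tau>\<bar> * (3 * (2 ^ k * (V * norm w) * K)))
          (\<lambda>x. \<tau> * (\<Sum>j\<in>UNIV. sdiff w (u j) x * central_diff h j G (x + w)))"
        by (intro dbound_cmult) simp
      moreover have "dbound A W k (K * norm w * (1 + 3 * 2 ^ k * V * \<tau>)) (step h \<tau> u (sdiff w G))"
        using Suc.prems w by (intro Suc.IH dbound_sdiff dbound_Suc_imp[OF Suc.prems(1)]) auto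
      ultimately show ?thesis
        unfolding sdiff_step using assms(4)
        by (intro dbound_mono[OF dbound_diff]) (auto simp: algebra_simps)
    qed
    with max[OF Suc.prems(3,2)] show ?case by simp
  qed
qed

subsection \<open>Partial derivatives of functions with bounded second differences\<close>

text \<open>Since \<open>\<phi>\<close> is merely continuous, its quotients are compared through an
  antiderivative \<open>P\<close>. By the mean value theorem the mixed difference
  \<open>P (r + q) - P r - P q + P 0\<close> is \<open>r\<close> times an increment of
  \<open>\<phi>\<close> of length \<open>q\<close>, and also \<open>q\<close> times an increment of
  length \<open>r\<close>. The bound on second differences moves both increments to 0, so the
  quotients at \<open>q\<close> and \<open>r\<close> differ by at most \<open>K * (r + q)\<close>
  for arbitrary positive reals. They are therefore Cauchy as the increment tends to 0.\<close>

lemma second_difference_derivative: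
  fixes \<phi> :: "real \<Rightarrow> real"
  assumes cont: "continuous_on UNIV \<phi>"
    and sd: "\<And>s a b. \<bar>\<phi> (s + a + b) - \<phi> (s + a) - \<phi> (s + b) + \<phi> s\<bar> \<le> K * \<bar>a\<bar> * \<bar>b\<bar>"
  obtains D where "\<And>r. \<bar>\<phi> r - \<phi> 0 - r * D\<bar> \<le> 2 * K * r\<^sup>2"
proof -
  have "0 \<le> K" using sd[of 0 1 1] by linarith
  have cross: "\<bar>(\<phi> q - \<phi> 0) / q - (\<phi> r - \<phi> 0) / r\<bar> \<le> K * (r + q)" if "0 < r" "0 < q" for r q
  proof -
    obtain P where P: "\<And>x. x \<in> {0..r + q} \<Longrightarrow> (P has_vector_derivative \<phi> x) (at x within {0..r + q})"
      using antiderivative_continuous[of 0 "r + q" \<phi>] continuous_on_subset[OF cont] by auto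
    have dP: "(P has_real_derivative \<phi> x) (at x within {0..r + q})" if "x \<in> {0..r + q}" for x
      using P[OF that] by (simp add: has_real_derivative_iff_has_vector_derivative)
    have mv: "\<exists>z\<in>{0..a}. P (a + b) - P a - P b + P 0 = a * (\<phi> (z + b) - \<phi> z)"
      if "0 < a" "0 < b" "a + b = r + q" for a b
    proof -
      have "((\<lambda>s. P (s + b) - P s) has_real_derivative \<phi> (x + b) - \<phi> x) (at x within {0..a})"
        if "x \<in> {0..a}" for x
      proof -
        have "(P has_real_derivative \<phi> (x + b)) (at (x + b) within (\<lambda>s. s + b) ` {0..a})"
          using that \<open>0 < a\<close> \<open>0 < b\<close> \<open>a + b = r + q\<close>
          by (intro DERIV_subset[OF dP]) auto
        moreover have "((\<lambda>s. s + b) has_real_derivative 1) (at x within {0..a})"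
          by (auto intro!: derivative_eq_intros)
        ultimately have "(P \<circ> (\<lambda>s. s + b) has_real_derivative \<phi> (x + b) * 1) (at x within {0..a})"
          by (rule DERIV_image_chain)
        then have "((\<lambda>s. P (s + b)) has_real_derivative \<phi> (x + b)) (at x within {0..a})"
          by (simp add: o_def)
        moreover have "(P has_real_derivative \<phi> x) (at x within {0..a})"
          using that \<open>0 < a\<close> \<open>0 < b\<close> \<open>a + b = r + q\<close> by (intro DERIV_subset[OF dP]) auto
        ultimately show ?thesis by (intro derivative_intros)
      qed
      then have "\<exists>z\<in>{0<..<a}. (P (a + b) - P a) - (P (0 + b) - P 0) = (\<phi> (z + b) - \<phi> z) * (a - 0)"
        using \<open>0 < a\<close>
        by (intro mvt_simple[where f' = "\<lambda>x y. (\<phi> (x + b) - \<phi> x) * y"])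
          (auto simp: has_field_derivative_def)
      then show ?thesis by (force simp: algebra_simps)
    qed
    obtain z where z: "z \<in> {0..r}" "P (r + q) - P r - P q + P 0 = r * (\<phi> (z + q) - \<phi> z)"
      using mv[of r q] \<open>0 < r\<close> \<open>0 < q\<close> by auto
    obtain y where y: "y \<in> {0..q}" "P (q + r) - P q - P r + P 0 = q * (\<phi> (y + r) - \<phi> y)"
      using mv[of q r] \<open>0 < r\<close> \<open>0 < q\<close> by auto
    have eq: "r * (\<phi> (z + q) - \<phi> z) = q * (\<phi> (y + r) - \<phi> y)"
      using z(2) y(2) by (simp add: add.commute)
    have "\<bar>\<phi> (0 + z + q) - \<phi> (0 + z) - \<phi> (0 + q) + \<phi> 0\<bar> \<le> K * r * q"
      using z(1) \<open>0 \<le> K\<close> \<open>0 < q\<close> by (intro order_trans[OF sd] mult_mono) auto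
    then have "r * \<bar>\<phi> (z + q) - \<phi> z - (\<phi> q - \<phi> 0)\<bar> \<le> r * (K * r * q)"
      using \<open>0 < r\<close> by (intro mult_left_mono) (auto simp: algebra_simps)
    moreover have "\<bar>\<phi> (0 + y + r) - \<phi> (0 + y) - \<phi> (0 + r) + \<phi> 0\<bar> \<le> K * q * r"
      using y(1) \<open>0 \<le> K\<close> \<open>0 < r\<close> by (intro order_trans[OF sd] mult_mono) auto
    then have "q * \<bar>\<phi> (y + r) - \<phi> y - (\<phi> r - \<phi> 0)\<bar> \<le> q * (K * q * r)"
      using \<open>0 < q\<close> by (intro mult_left_mono) (auto simp: algebra_simps)
    ultimately have "\<bar>r * (\<phi> (z + q) - \<phi> z - (\<phi> q - \<phi> 0))\<bar> + \<bar>q * (\<phi> (y + r) - \<phi> y - (\<phi> r - \<phi> 0))\<bar>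
        \<le> r * (K * r * q) + q * (K * q * r)"
      unfolding abs_mult abs_of_pos[OF \<open>0 < q\<close>] abs_of_pos[OF \<open>0 < r\<close>] by (rule add_mono)
    moreover have "r * (K * r * q) + q * (K * q * r) = r * q * (K * (r + q))"
      by (simp add: algebra_simps)
    moreover have "r * (\<phi> q - \<phi> 0) - q * (\<phi> r - \<phi> 0) =
        q * (\<phi> (y + r) - \<phi> y - (\<phi> r - \<phi> 0)) - r * (\<phi> (z + q) - \<phi> z - (\<phi> q - \<phi> 0))"
      using eq by (simp add: algebra_simps)
    ultimately have "\<bar>r * (\<phi> q - \<phi> 0) - q * (\<phi> r - \<phi> 0)\<bar> \<le> r * q * (K * (r + q))"
      by linarith
    moreover have "r * (\<phi> q - \<phi> 0) - q * (\<phi> r - \<phi> 0) = r * q * ((\<phi> q - \<phi> 0) / q - (\<phi> r - \<phi> 0) / r)"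
      using \<open>0 < q\<close> \<open>0 < r\<close> by (simp add: field_simps)
    ultimately have "r * q * \<bar>(\<phi> q - \<phi> 0) / q - (\<phi> r - \<phi> 0) / r\<bar> \<le> r * q * (K * (r + q))"
      using \<open>0 < q\<close> \<open>0 < r\<close> by (simp add: abs_mult)
    then show ?thesis using \<open>0 < q\<close> \<open>0 < r\<close> by (simp add: mult_le_cancel_left)
  qed
  define a where "a n = (\<phi> (inverse (real (Suc n))) - \<phi> 0) / inverse (real (Suc n))" for n
  have "Cauchy a"
  proof (rule metric_CauchyI)
    fix e :: real assume "0 < e"
    obtain M where M: "inverse (real (Suc M)) < e / (2 * (K + 1))"
      using reals_Archimedean[of "e / (2 * (K + 1))"] \<open>0 < e\<close> \<open>0 \<le> K\<close> by auto
    have le: "inverse (real (Suc n)) \<le> inverse (real (Suc M))" if "n \<ge> M" for n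
      using that by (auto intro!: le_imp_inverse_le)
    have "dist (a m) (a n) < e" if "m \<ge> M" "n \<ge> M" for m n
    proof -
      have "dist (a m) (a n) \<le> K * (inverse (real (Suc n)) + inverse (real (Suc m)))"
        unfolding a_def dist_real_def by (rule cross) auto
      also have "\<dots> \<le> K * (2 * inverse (real (Suc M)))"
        using add_mono[OF le[OF that(2)] le[OF that(1)]] \<open>0 \<le> K\<close> by (intro mult_left_mono) simp_all
      also have "\<dots> \<le> (K + 1) * (2 * inverse (real (Suc M)))"
        by (intro mult_right_mono) auto
      also have "\<dots> < e" using M \<open>0 \<le> K\<close> by (simp add: field_simps)
      finally show ?thesis .
    qed
    then show "\<exists>M. \<forall>m\<ge>M. \<forall>n\<ge>M. dist (a m) (a n) < e" by blast
  qed
  then obtain D where D: "a \<longlonglongrightarrow> D"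
    using Cauchy_convergent convergent_def by blast
  have pos: "\<bar>\<phi> r - \<phi> 0 - r * D\<bar> \<le> K * r\<^sup>2" if "0 < r" for r
  proof -
    have "(\<lambda>n. K * (r + inverse (real (Suc n))) - \<bar>a n - (\<phi> r - \<phi> 0) / r\<bar>) \<longlonglongrightarrow>
        K * (r + 0) - \<bar>D - (\<phi> r - \<phi> 0) / r\<bar>"
      by (intro tendsto_intros D LIMSEQ_inverse_real_of_nat)
    moreover have "0 \<le> K * (r + inverse (real (Suc n))) - \<bar>a n - (\<phi> r - \<phi> 0) / r\<bar>" for n
      using cross[OF that, of "inverse (real (Suc n))"] by (simp add: a_def)
    ultimately have "0 \<le> K * (r + 0) - \<bar>D - (\<phi> r - \<phi> 0) / r\<bar>"
      by (intro LIMSEQ_le_const) auto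
    then have "r * \<bar>D - (\<phi> r - \<phi> 0) / r\<bar> \<le> r * (K * r)"
      using that by (intro mult_left_mono) auto
    moreover have "r * \<bar>D - (\<phi> r - \<phi> 0) / r\<bar> = \<bar>r * (D - (\<phi> r - \<phi> 0) / r)\<bar>"
      using that by (simp add: abs_mult)
    moreover have "r * (D - (\<phi> r - \<phi> 0) / r) = - (\<phi> r - \<phi> 0 - r * D)"
      using that by (simp add: field_simps)
    ultimately show ?thesis by (simp only: abs_minus_cancel power2_eq_square mult_ac)
  qed
  have "\<bar>\<phi> r - \<phi> 0 - r * D\<bar> \<le> 2 * K * r\<^sup>2" for r
  proof (cases "r < 0")
    case True
    have "\<bar>\<phi> (- r) - \<phi> 0 - (- r) * D\<bar> \<le> K * r\<^sup>2" using pos[of "- r"] True by simp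
    \<comment> \<open>Negative arguments are reflected by the symmetric second difference at 0,
      whose bound is the second \<open>K\<close> in the factor 2.\<close>
    moreover have "\<bar>\<phi> (- r) - \<phi> 0 - \<phi> 0 + \<phi> r\<bar> \<le> K * r\<^sup>2"
      using sd[of r "- r" "- r"] True by (simp add: power2_eq_square)
    ultimately show ?thesis by (simp add: algebra_simps)
  next
    case False
    moreover have "K * r\<^sup>2 \<le> 2 * K * r\<^sup>2" using \<open>0 \<le> K\<close> by simp
    ultimately show ?thesis using pos[of r] by (cases "r = 0") auto
  qed
  with that show thesis by blast
qed

text \<open>\<open>partial_deriv\<close> is a \<open>deriv\<close> and carries information only
  where a derivative exists; the second part supplies this for every function with bounded second
  differences.\<close>

lemma partial_deriv_expansion:
  assumes "ubound 2 K F"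
  shows "\<bar>sdiff (r *\<^sub>R axis i 1) F x - r * partial_deriv i F x\<bar> \<le> 2 * K * r\<^sup>2"
    and "((\<lambda>s. F (x + s *\<^sub>R axis i 1)) has_real_derivative partial_deriv i F x) (at 0)"
proof -
  have F: "ubound (Suc (Suc 0)) K F" using assms by (simp add: numeral_2_eq_2 del: dbound.simps)
  define \<phi> where "\<phi> s = F (x + s *\<^sub>R axis i 1)" for s
  have "continuous_on UNIV \<phi>"
    unfolding \<phi>_def using ubound_continuous[OF F, of UNIV]
    by (rule continuous_on_compose2) (auto intro!: continuous_intros)
  moreover have "\<bar>\<phi> (s + a + b) - \<phi> (s + a) - \<phi> (s + b) + \<phi> s\<bar> \<le> K * \<bar>a\<bar> * \<bar>b\<bar>" for s a b
    using dbound_bound[OF dbound_sdiff[OF dbound_sdiff[OF F, of "a *\<^sub>R axis i 1"], of "b *\<^sub>R axis i 1"],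
        of "x + s *\<^sub>R axis i 1"]
    by (simp add: \<phi>_def sdiff_def algebra_simps)
  ultimately obtain D where D: "\<And>r. \<bar>\<phi> r - \<phi> 0 - r * D\<bar> \<le> 2 * K * r\<^sup>2"
    by (rule second_difference_derivative) blast
  have "((\<lambda>r. (\<phi> (0 + r) - \<phi> 0) / r - D) \<longlongrightarrow> 0) (at 0)"
  proof (rule Lim_null_comparison)
    have "\<bar>(\<phi> (0 + r) - \<phi> 0) / r - D\<bar> \<le> 2 * K * \<bar>r\<bar>" if "r \<noteq> 0" for r
    proof -
      have "\<bar>r\<bar> * \<bar>(\<phi> (0 + r) - \<phi> 0) / r - D\<bar> = \<bar>\<phi> r - \<phi> 0 - r * D\<bar>"
        using that by (simp add: abs_mult[symmetric] field_simps)
      also have "\<dots> \<le> \<bar>r\<bar> * (2 * K * \<bar>r\<bar>)" using D[of r] by (simp add: power2_eq_square mult_ac)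
      finally show ?thesis using that by simp
    qed
    then show "\<forall>\<^sub>F r in at 0. norm ((\<phi> (0 + r) - \<phi> 0) / r - D) \<le> 2 * K * \<bar>r\<bar>"
      by (auto simp: eventually_at_filter)
    show "((\<lambda>r. 2 * K * \<bar>r\<bar>) \<longlongrightarrow> 0) (at 0)"
      by (auto intro!: tendsto_eq_intros)
  qed
  then have deriv: "(\<phi> has_real_derivative D) (at 0)"
    unfolding DERIV_def by (simp add: LIM_zero_iff)
  then have "partial_deriv i F x = D"
    unfolding partial_deriv_def \<phi>_def[symmetric] by (rule DERIV_imp_deriv)
  with D deriv show "\<bar>sdiff (r *\<^sub>R axis i 1) F x - r * partial_deriv i F x\<bar> \<le> 2 * K * r\<^sup>2"
    "((\<lambda>s. F (x + s *\<^sub>R axis i 1)) has_real_derivative partial_deriv i F x) (at 0)"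
    unfolding \<phi>_def[abs_def] sdiff_def by auto
qed

section \<open>Partial derivatives and iterated differences\<close>

lemma partial_deriv_diff:
  assumes "ubound 2 K F" "ubound 2 L G"
  shows "partial_deriv i (\<lambda>y. F y - G y) x = partial_deriv i F x - partial_deriv i G x"
  unfolding partial_deriv_def[of i "\<lambda>y. F y - G y"]
  by (rule DERIV_imp_deriv) (intro derivative_intros partial_deriv_expansion(2)[OF assms(1)] partial_deriv_expansion(2)[OF assms(2)])

lemma partial_deriv_sdiff:
  assumes "ubound 2 K F"
  shows "partial_deriv i (sdiff w F) = sdiff w (partial_deriv i F)"
proof
  fix x
  have "ubound 2 K (\<lambda>y. F (y + w))" using assms by (intro dbound_shift) auto
  from partial_deriv_diff[OF this assms, of i x]
  show "partial_deriv i (sdiff w F) x = sdiff w (partial_deriv i F) x"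
    unfolding sdiff_def[abs_def] partial_deriv_def by (simp add: algebra_simps)
qed

text \<open>\<open>partial_deriv\<close> commutes with \<open>sdiff\<close>, so the quadratic
  expansion can be applied to every difference of \<open>F\<close> of order up to \<open>k\<close>.
  The two further orders are what the expansion itself consumes.\<close>

lemma ubound_quotient_partial_deriv:
  assumes "ubound (k + 2) K F" "r \<noteq> 0"
  shows "ubound k (2 * K * \<bar>r\<bar>) (\<lambda>x. sdiff (r *\<^sub>R axis i 1) F x / r - partial_deriv i F x)"
  using assms(1)
proof (induction k arbitrary: K F)
  have base: "\<bar>sdiff (r *\<^sub>R axis i 1) F x / r - partial_deriv i F x\<bar> \<le> 2 * K * \<bar>r\<bar>"
    if "ubound 2 K F" for K F x
  proof -
    have "\<bar>r\<bar> * \<bar>sdiff (r *\<^sub>R axis i 1) F x / r - partial_deriv i F x\<bar>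
        = \<bar>sdiff (r *\<^sub>R axis i 1) F x - r * partial_deriv i F x\<bar>"
      using assms(2) by (simp add: abs_mult[symmetric] field_simps)
    also have "\<dots> \<le> \<bar>r\<bar> * (2 * K * \<bar>r\<bar>)"
      using partial_deriv_expansion(1)[OF that, of r i x] by (simp add: power2_eq_square mult_ac)
    finally show ?thesis using assms(2) by simp
  qed
  {
    case 0
    then have "ubound 2 K F" by (simp add: numeral_2_eq_2 del: dbound.simps)
    then show ?case using base by simp
  next
    case (Suc k)
    have F2: "ubound 2 K F" by (rule dbound_le[OF Suc.prems]) simp
    have "ubound k (2 * K * \<bar>r\<bar> * norm w) (sdiff w (\<lambda>x. sdiff (r *\<^sub>R axis i 1) F x / r - partial_deriv i F x))" for w
    proof -
      have "ubound (k + 2) (K * norm w) (sdiff w F)"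
        using dbound_sdiff[of UNIV UNIV "k + 2" K F w] Suc.prems by simp
      from Suc.IH[OF this] show ?thesis
        unfolding partial_deriv_sdiff[OF F2]
        by (simp add: sdiff_def[abs_def] algebra_simps diff_divide_distrib add_divide_distrib)
    qed
    then show ?case using base[OF F2] by simp
  }
qed

text \<open>The quotients with increment \<open>r n\<close> all have the bound \<open>K\<close> of
  order \<open>k\<close>, and it survives the limit, so a derivative costs a single order. The
  condition \<open>1 \<le> k\<close> provides the second differences that make the quotients
  converge.\<close>

lemma ubound_partial_deriv:
  assumes "ubound (Suc k) K F" "1 \<le> k"
  shows "ubound k K (partial_deriv i F)"
proof (rule dbound_LIMSEQ)
  have F2: "ubound 2 K F" by (rule dbound_le[OF assms(1)]) (use assms(2) in simp)
  define r where "r n = inverse (real (Suc n))" for n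
  have r: "0 < r n" for n by (simp add: r_def)
  show "ubound k K (\<lambda>x. sdiff (r n *\<^sub>R axis i 1) F x / r n)" for n
    using dbound_cmult[OF dbound_sdiff[OF assms(1), of "r n *\<^sub>R axis i 1"], of "1 / r n"] r[of n]
    by simp
  show "(\<lambda>n. sdiff (r n *\<^sub>R axis i 1) F x / r n) \<longlonglongrightarrow> partial_deriv i F x" for x
  proof (rule LIM_zero_cancel, rule Lim_null_comparison)
    show "\<forall>\<^sub>F n in sequentially. norm (sdiff (r n *\<^sub>R axis i 1) F x / r n - partial_deriv i F x) \<le> 2 * K * r n"
    proof (intro always_eventually allI)
      fix n
      have "ubound (0 + 2) K F" using F2 by (simp add: numeral_2_eq_2 del: dbound.simps)
      from dbound_bound[OF ubound_quotient_partial_deriv[OF this, of "r n" i], of x] r[of n]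
      show "norm (sdiff (r n *\<^sub>R axis i 1) F x / r n - partial_deriv i F x) \<le> 2 * K * r n"
        by simp
    qed
    show "(\<lambda>n. 2 * K * r n) \<longlonglongrightarrow> 0"
      unfolding r_def using tendsto_mult[OF tendsto_const LIMSEQ_inverse_real_of_nat, of "2 * K"] by simp
  qed
qed

section \<open>Taylor expansion and axis-parallel increments\<close>

lemma sdiff_add: "sdiff (v + w) F x = sdiff v F (x + w) + sdiff w F x"
  by (simp add: sdiff_def algebra_simps)

lemma vec3_decompose: "(w :: real^3) = (w $ 1) *\<^sub>R axis 1 1 + ((w $ 2) *\<^sub>R axis 2 1 + (w $ 3) *\<^sub>R axis 3 (1::real))"
  by (simp add: vec_eq_iff forall_3 axis_def)

text \<open>The increment is travelled in three axis-parallel legs. The axis expansions cost 2 each;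
  moving the base points of the first two legs back to \<open>x\<close> costs 2 and 1. This adds up
  to 9.\<close>

lemma taylor_ubound2:
  fixes F :: "real^3 \<Rightarrow> real"
  assumes "ubound 2 K F"
  shows "\<bar>F (x + w) - F x - (\<Sum>j\<in>UNIV. w $ j * partial_deriv j F x)\<bar> \<le> 9 * K * (norm w)\<^sup>2"
proof -
  have K: "0 \<le> K" using dbound_nonneg[OF assms] by simp
  let ?w = "\<lambda>j. (w $ j) *\<^sub>R axis j 1 :: real^3"
  have n: "norm (?w j) \<le> norm w" for j by (simp add: component_le_norm_cart)
  have e: "\<bar>sdiff (?w j) F x - w $ j * partial_deriv j F x\<bar> \<le> 2 * K * (norm w)\<^sup>2" for j
    using K component_le_norm_cart[of w j]
    by (intro order_trans[OF partial_deriv_expansion(1)[OF assms]] mult_left_mono) (auto simp: abs_le_square_iff[symmetric])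
  have d: "\<bar>sdiff a F (x + b) - sdiff a F x\<bar> \<le> K * norm a * norm b" for a b
    using ubound_Lipschitz[OF dbound_sdiff[of UNIV UNIV "Suc 0" K F a], of "x + b" x] assms
    by (simp add: numeral_2_eq_2 del: dbound.simps)
  have d1: "\<bar>sdiff (?w 1) F (x + (?w 2 + ?w 3)) - sdiff (?w 1) F x\<bar> \<le> K * norm w * (2 * norm w)"
    using K n[of 1] n[of 2] n[of 3] by (intro order_trans[OF d] mult_mono order_trans[OF norm_triangle_ineq]) auto
  have d2: "\<bar>sdiff (?w 2) F (x + ?w 3) - sdiff (?w 2) F x\<bar> \<le> K * norm w * norm w"
    using K n[of 2] n[of 3] by (intro order_trans[OF d] mult_mono) auto
  have "F (x + w) - F x = sdiff (?w 1) F (x + (?w 2 + ?w 3)) + (sdiff (?w 2) F (x + ?w 3) + sdiff (?w 3) F x)"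
    unfolding sdiff_add[symmetric] using vec3_decompose[of w] by (simp add: sdiff_def)
  then show ?thesis
    using d1 d2 e[of 1] e[of 2] e[of 3] unfolding sum_3 power2_eq_square by linarith
qed

text \<open>Every increment splits into three axis-parallel ones that are no longer than itself,
  which gives a factor 3 for each order.\<close>

lemma dbound_axis_imp_ubound:
  fixes \<phi> :: "real^3 \<Rightarrow> real"
  assumes "dbound UNIV (\<Union>j. range (\<lambda>r. r *\<^sub>R axis j 1)) k K \<phi>"
  shows "ubound k (3 ^ k * K) \<phi>"
  using assms
proof (induction k arbitrary: K \<phi>)
  case (Suc k)
  let ?W = "\<Union>j. range (\<lambda>r. r *\<^sub>R axis j 1) :: (real^3) set"
  have K: "0 \<le> K" using dbound_nonneg[OF Suc.prems] by simp
  have "ubound k (3 ^ Suc k * K * norm w) (sdiff w \<phi>)" for w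
  proof -
    let ?w = "\<lambda>j. (w $ j) *\<^sub>R axis j 1 :: real^3"
    have "dbound UNIV ?W k (K * norm w) (sdiff (?w j) \<phi>)" for j
      using K component_le_norm_cart[of w j]
      by (intro dbound_mono[OF dbound_sdiff[OF Suc.prems]] mult_left_mono) auto
    then have "dbound UNIV ?W k (K * norm w + (K * norm w + K * norm w))
      (\<lambda>x. sdiff (?w 1) \<phi> (x + (?w 2 + ?w 3)) + (sdiff (?w 2) \<phi> (x + ?w 3) + sdiff (?w 3) \<phi> x))"
      by (intro dbound_add dbound_shift) auto
    moreover have "sdiff w \<phi> = (\<lambda>x. sdiff (?w 1) \<phi> (x + (?w 2 + ?w 3)) + (sdiff (?w 2) \<phi> (x + ?w 3) + sdiff (?w 3) \<phi> x))"
      unfolding sdiff_add[symmetric] using vec3_decompose[of w] by (simp add: sdiff_def[abs_def])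
    ultimately have "dbound UNIV ?W k (K * norm w + (K * norm w + K * norm w)) (sdiff w \<phi>)"
      by simp
    from Suc.IH[OF this] show ?thesis by (simp add: algebra_simps)
  qed
  moreover have "\<bar>\<phi> x\<bar> \<le> 3 ^ Suc k * K" for x
  proof -
    have "\<bar>\<phi> x\<bar> \<le> 1 * K" using dbound_bound[OF Suc.prems] by simp
    also have "\<dots> \<le> 3 ^ Suc k * K" using K by (intro mult_right_mono one_le_power) auto
    finally show ?thesis .
  qed
  ultimately show ?case by simp
qed simp

subsection \<open>Regularity of the zero extensions\<close>

text \<open>The mean value inequality is applied to \<open>\<phi>\<close> and, by induction, to its
  differences: \<open>sdiff w \<phi>\<close> has the directional derivative
  \<open>sdiff w \<psi>\<close>.\<close>

lemma dbound_directional_derivative: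
  fixes \<phi> :: "'a::real_normed_vector \<Rightarrow> real"
  assumes "shift_closed A W" "\<And>z s. z \<in> A \<Longrightarrow> z + s *\<^sub>R b \<in> A" "norm b = 1"
    and "\<And>z. z \<in> A \<Longrightarrow> ((\<lambda>s. \<phi> (z + s *\<^sub>R b)) has_real_derivative \<psi> z) (at 0)"
    and "dbound A W k K \<psi>"
  shows "dbound A W k (K * \<bar>r\<bar>) (sdiff (r *\<^sub>R b) \<phi>)"
  using assms(4,5)
proof (induction k arbitrary: K \<phi> \<psi>)
  have base: "\<bar>sdiff (r *\<^sub>R b) \<phi> z\<bar> \<le> K * \<bar>r\<bar>"
    if d: "\<And>z. z \<in> A \<Longrightarrow> ((\<lambda>s. \<phi> (z + s *\<^sub>R b)) has_real_derivative \<psi> z) (at 0)"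
      and bd: "dbound A W k K \<psi>" and z: "z \<in> A" for K \<phi> \<psi> k z
  proof -
    have "((\<lambda>s. \<phi> (z + s *\<^sub>R b)) has_real_derivative \<psi> (z + s *\<^sub>R b)) (at s)" for s
    proof -
      have "((\<lambda>x. \<phi> (z + s *\<^sub>R b + x *\<^sub>R b)) has_real_derivative \<psi> (z + s *\<^sub>R b)) (at 0)"
        by (rule d[OF assms(2)[OF z]])
      then have "((\<lambda>x. \<phi> (z + (x + s) *\<^sub>R b)) has_real_derivative \<psi> (z + s *\<^sub>R b)) (at 0)"
        by (simp add: algebra_simps)
      then show ?thesis
        using DERIV_shift[of "\<lambda>s. \<phi> (z + s *\<^sub>R b)" "\<psi> (z + s *\<^sub>R b)" 0 s] by simp
    qed
    then have "norm (\<phi> (z + r *\<^sub>R b) - \<phi> (z + 0 *\<^sub>R b)) \<le> K * norm (r - 0)"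
      using dbound_bound[OF bd assms(2)[OF z]]
      by (intro field_differentiable_bound[of UNIV _ "\<lambda>s. \<psi> (z + s *\<^sub>R b)"]) auto
    then show ?thesis by (simp add: sdiff_def)
  qed
  {
    case 0
    show ?case using base[OF 0] by simp
  next
    case (Suc k)
    have "dbound A W k (K * \<bar>r\<bar> * norm w) (sdiff w (sdiff (r *\<^sub>R b) \<phi>))" if w: "w \<in> W" for w
    proof -
      have "((\<lambda>s. sdiff w \<phi> (z + s *\<^sub>R b)) has_real_derivative sdiff w \<psi> z) (at 0)" if "z \<in> A" for z
      proof -
        have "((\<lambda>s. \<phi> ((z + w) + s *\<^sub>R b) - \<phi> (z + s *\<^sub>R b)) has_real_derivative \<psi> (z + w) - \<psi> z) (at 0)"
          using that w assms(1) by (intro DERIV_diff Suc.prems(1)) (auto simp: shift_closed_def)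
        then show ?thesis by (simp add: sdiff_def[abs_def] algebra_simps)
      qed
      from Suc.IH[OF this dbound_sdiff[OF Suc.prems(2) w]]
      have "dbound A W k (K * norm w * \<bar>r\<bar>) (sdiff (r *\<^sub>R b) (sdiff w \<phi>))" .
      moreover have "sdiff (r *\<^sub>R b) (sdiff w \<phi>) = sdiff w (sdiff (r *\<^sub>R b) \<phi>)"
        by (auto simp: sdiff_def algebra_simps)
      ultimately show ?thesis by (simp add: mult_ac)
    qed
    then show ?case using base[OF Suc.prems] by simp
  }
qed

text \<open>\<open>S\<close> is a closed set carrying the support of \<open>\<phi>\<close>, and
  \<open>A\<close> meets it only inside \<open>U\<close>. A point of \<open>A\<close> off
  \<open>U\<close> therefore has a neighbourhood on which the extension vanishes, so along the lines
  in \<open>A\<close> the derivative of the extension is the zero extension of the derivative.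
  Restricting \<open>A\<close> and the directions \<open>I\<close> allows the velocity to be
  differenced in space only, since it need not vanish at the end times.\<close>

lemma Ck_closure_imp_dbound:
  fixes \<phi> :: "'a::euclidean_space \<Rightarrow> real"
  assumes "open U" "bounded U" "closed S" "A \<inter> S \<subseteq> U" "I \<subseteq> Basis"
    and A: "\<And>z s b. z \<in> A \<Longrightarrow> b \<in> I \<Longrightarrow> z + s *\<^sub>R b \<in> A"
    and "Ck_closure k U \<phi>" "\<And>z. z \<in> U - S \<Longrightarrow> \<phi> z = 0"
  shows "\<exists>K. dbound A (\<Union>b\<in>I. range (\<lambda>s. s *\<^sub>R b)) k K (extend_zero U \<phi>)"
  using assms(7,8)
proof (induction k arbitrary: \<phi>)
  have bdd: "\<exists>K\<ge>0. \<forall>z. \<bar>extend_zero U \<phi> z\<bar> \<le> K" if "continuous_on (closure U) \<phi>" for \<phi> :: "'a \<Rightarrow> real"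
  proof -
    have "bounded (\<phi> ` closure U)"
      using assms(2) that by (intro compact_imp_bounded compact_continuous_image) auto
    then obtain K where K: "\<And>z. z \<in> closure U \<Longrightarrow> \<bar>\<phi> z\<bar> \<le> K"
      unfolding bounded_iff by auto
    have "\<bar>extend_zero U \<phi> z\<bar> \<le> max K 0" for z
      using K[of z] closure_subset[of U] by (auto simp: extend_zero_def)
    then show ?thesis by (intro exI[of _ "max K 0"]) auto
  qed
  {
    case 0
    then show ?case using bdd[of \<phi>] by auto
  next
    case (Suc k)
    let ?W = "\<Union>b\<in>I. range (\<lambda>s. s *\<^sub>R b)"
    have W: "shift_closed A ?W" using A by (auto simp: shift_closed_def)
    have "\<exists>K\<ge>0. \<forall>r. dbound A ?W k (K * \<bar>r\<bar>) (sdiff (r *\<^sub>R b) (extend_zero U \<phi>))" if b: "b \<in> I" for b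
    proof -
      have "b \<in> Basis" using b assms(5) by auto
      with Suc.prems(1) obtain \<psi> where \<psi>: "Ck_closure k U \<psi>"
        "\<And>z. z \<in> U \<Longrightarrow> ((\<lambda>s. \<phi> (z + s *\<^sub>R b)) has_real_derivative \<psi> z) (at 0)"
        by (auto simp: has_real_derivative_iff_has_vector_derivative)
      have line: "\<forall>\<^sub>F s in nhds 0. z + s *\<^sub>R b \<in> V" if "open V" "z \<in> V" for z V
      proof -
        have "open ((\<lambda>s. z + s *\<^sub>R b) -` V)"
          by (intro open_vimage that continuous_intros)
        then show ?thesis
          using that eventually_nhds[of "\<lambda>s. z + s *\<^sub>R b \<in> V" 0] by auto
      qed
      \<comment> \<open>The support condition has to be inherited by the derivative before the
        induction hypothesis applies to it.\<close>
      have zero: "\<psi> z = 0" if "z \<in> U - S" for z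
      proof -
        have "\<forall>\<^sub>F s in nhds 0. \<phi> (z + s *\<^sub>R b) = 0"
          using line[of "U - S" z] assms(1,3) that Suc.prems(2) by (auto intro: eventually_mono)
        then have "((\<lambda>s. \<phi> (z + s *\<^sub>R b)) has_real_derivative 0) (at 0)"
          by (subst DERIV_cong_ev[OF refl _ refl]) auto
        with \<psi>(2)[of z] that show ?thesis by (auto dest: DERIV_unique)
      qed
      have deriv: "((\<lambda>s. extend_zero U \<phi> (z + s *\<^sub>R b)) has_real_derivative extend_zero U \<psi> z) (at 0)"
        if z: "z \<in> A" for z
      proof (cases "z \<in> U")
        case True
        have "\<forall>\<^sub>F s in nhds 0. extend_zero U \<phi> (z + s *\<^sub>R b) = \<phi> (z + s *\<^sub>R b)"
          using line[OF assms(1) True] by (auto simp: extend_zero_def elim!: eventually_mono)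
        then show ?thesis
          using \<psi>(2)[OF True] True by (subst DERIV_cong_ev[OF refl _ refl]) (auto simp: extend_zero_def)
      next
        case False
        then have "z \<in> - S" using z assms(4) by auto
        have "\<forall>\<^sub>F s in nhds 0. extend_zero U \<phi> (z + s *\<^sub>R b) = 0"
        proof (rule eventually_mono)
          show "\<forall>\<^sub>F s in nhds 0. z + s *\<^sub>R b \<in> - S"
            using \<open>z \<in> - S\<close> assms(3) by (intro line) auto
        qed (use Suc.prems(2) in \<open>auto simp: extend_zero_def\<close>)
        then show ?thesis
          using False by (subst DERIV_cong_ev[OF refl _ refl]) (auto simp: extend_zero_def)
      qed
      obtain K where K: "dbound A ?W k K (extend_zero U \<psi>)"
        using Suc.IH[OF \<psi>(1) zero] by auto
      then have "dbound A ?W k (max K 0) (extend_zero U \<psi>)"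
        by (rule dbound_mono) simp
      then have "dbound A ?W k (max K 0 * \<bar>r\<bar>) (sdiff (r *\<^sub>R b) (extend_zero U \<phi>))" for r
        using A b \<open>b \<in> Basis\<close> deriv
        by (intro dbound_directional_derivative[where \<psi> = "extend_zero U \<psi>"] W) auto
      then show ?thesis by (intro exI[of _ "max K 0"]) auto
    qed
    then obtain K where K: "\<And>b. b \<in> I \<Longrightarrow> 0 \<le> K b"
      "\<And>b r. b \<in> I \<Longrightarrow> dbound A ?W k (K b * \<bar>r\<bar>) (sdiff (r *\<^sub>R b) (extend_zero U \<phi>))"
      by metis
    obtain L where L: "0 \<le> L" "\<And>z. \<bar>extend_zero U \<phi> z\<bar> \<le> L"
      using bdd[of \<phi>] Suc.prems by auto
    have fin: "finite I" using assms(5) finite_Basis finite_subset by blast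
    have "dbound A ?W k ((L + sum K I) * norm w) (sdiff w (extend_zero U \<phi>))" if w: "w \<in> ?W" for w
    proof -
      obtain b r where b: "b \<in> I" "w = r *\<^sub>R b" using w by auto
      have "K b \<le> L + sum K I" using L(1) member_le_sum[of b I K] K(1) b(1) fin by auto
      moreover have "norm w = \<bar>r\<bar>" using b assms(5) by auto
      ultimately have "K b * \<bar>r\<bar> \<le> (L + sum K I) * norm w" by (simp add: mult_right_mono)
      from dbound_mono[OF K(2)[OF b(1), of r] this] show ?thesis unfolding b(2) .
    qed
    moreover have "\<bar>extend_zero U \<phi> z\<bar> \<le> L + sum K I" for z
      using L(2)[of z] sum_nonneg[of I K] K(1) by simp
    ultimately show ?case unfolding dbound.simps by blast
  }
qed

lemma Ck_closure_component:
  fixes \<phi> :: "'a::euclidean_space \<Rightarrow> real^'n"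
  assumes "Ck_closure k U \<phi>" shows "Ck_closure k U (\<lambda>z. \<phi> z $ i)"
  using assms
proof (induction k arbitrary: \<phi>)
  case (Suc k)
  show ?case
    unfolding Ck_closure.simps
  proof (intro conjI ballI)
    show "continuous_on (closure U) (\<lambda>z. \<phi> z $ i)"
      using Suc.prems by (auto intro: continuous_intros)
    fix b :: 'a assume "b \<in> Basis"
    with Suc.prems obtain \<psi> where "Ck_closure k U \<psi>"
      "\<forall>z\<in>U. ((\<lambda>s. \<phi> (z + s *\<^sub>R b)) has_vector_derivative \<psi> z) (at 0)" by auto
    then show "\<exists>\<psi>. Ck_closure k U \<psi> \<and>
        (\<forall>z\<in>U. ((\<lambda>s. \<phi> (z + s *\<^sub>R b) $ i) has_vector_derivative \<psi> z) (at 0))"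
      by (intro exI[of _ "\<lambda>z. \<psi> z $ i"])
        (auto intro: Suc.IH bounded_linear.has_vector_derivative[OF bounded_linear_vec_nth])
  qed
qed (auto intro: continuous_intros)

lemma dbound_slice:
  fixes \<Phi> :: "real \<times> 'a::real_normed_vector \<Rightarrow> real"
  assumes "dbound (J \<times> A) ((\<lambda>w. (0, w)) ` W) k K \<Phi>" "t \<in> J"
  shows "dbound A W k K (\<lambda>x. \<Phi> (t, x))"
  using assms(1)
proof (induction k arbitrary: K \<Phi>)
  case (Suc k)
  have "sdiff w (\<lambda>x. \<Phi> (t, x)) = (\<lambda>x. sdiff (0, w) \<Phi> (t, x))" for w
    by (auto simp: sdiff_def)
  with Suc show ?case using assms(2) by (auto simp: norm_Pair)
qed (use assms(2) in auto)

lemma initial_ubound: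
  fixes f0 :: "real^3 \<Rightarrow> real"
  assumes "open \<Omega>" "bounded \<Omega>" "admissible_initial \<Omega> f0"
  obtains K where "ubound 4 K (extend_zero \<Omega> f0)"
proof -
  obtain N where N: "Ck_closure 4 \<Omega> f0" "open N" "frontier \<Omega> \<subseteq> N" "\<And>x. x \<in> N \<inter> closure \<Omega> \<Longrightarrow> f0 x = 0"
    using assms(3) unfolding admissible_initial_def by auto
  let ?I = "range (\<lambda>j. axis j (1::real)) :: (real^3) set"
  have "\<exists>K. dbound UNIV (\<Union>b\<in>?I. range (\<lambda>s. s *\<^sub>R b)) 4 K (extend_zero \<Omega> f0)"
  \<comment> \<open>This set is closed and lies in \<open>\<Omega>\<close> because \<open>N\<close>
    covers the frontier.\<close>
  proof (rule Ck_closure_imp_dbound[where S = "closure \<Omega> - N"])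
    show "UNIV \<inter> (closure \<Omega> - N) \<subseteq> \<Omega>"
      using N(3) assms(1) by (auto simp: frontier_def interior_open)
    show "f0 z = 0" if "z \<in> \<Omega> - (closure \<Omega> - N)" for z
      using N(4)[of z] that closure_subset[of \<Omega>] by auto
  qed (use assms N in \<open>auto simp: axis_in_Basis_iff\<close>)
  then obtain K where "dbound UNIV (\<Union>j. range (\<lambda>s. s *\<^sub>R axis j 1)) 4 K (extend_zero \<Omega> f0)"
    by auto
  from dbound_axis_imp_ubound[OF this] that show thesis by blast
qed

text \<open>For joint continuity the extension is glued from two closed pieces of space-time, over
  \<open>closure \<Omega>\<close> and over the complement of \<open>\<Omega>\<close>; on the overlap
  \<open>v\<close> vanishes because its support lies over \<open>\<Omega>\<close>. The derivatives
  live on the open time interval only, so the difference bounds are first obtained there.\<close>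

lemma velocity_regularity:
  fixes v :: "real \<Rightarrow> real^3 \<Rightarrow> real^3"
  assumes "T > 0" "open \<Omega>" "bounded \<Omega>" "admissible_velocity T \<Omega> v"
  obtains K where "\<And>t i. t \<in> {0..T} \<Longrightarrow> ubound 4 K (\<lambda>x. extend_zero \<Omega> (v t) x $ i)"
    and "continuous_on ({0..T} \<times> UNIV) (\<lambda>(t, x). extend_zero \<Omega> (v t) x)"
proof -
  define U where "U = {0<..<T} \<times> \<Omega>"
  define S where "S = closure {(t, x). t \<in> {0..T} \<and> x \<in> closure \<Omega> \<and> v t x \<noteq> 0}"
  have Ck: "Ck_closure 4 U (\<lambda>(t, x). v t x)" and S: "S \<subseteq> {0..T} \<times> \<Omega>"
    using assms(4) by (auto simp: admissible_velocity_def U_def S_def)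
  have clU: "closure U = {0..T} \<times> closure \<Omega>"
    unfolding U_def closure_Times using assms(1) by simp
  have zero: "v t x = 0" if "t \<in> {0..T}" "x \<in> closure \<Omega>" "(t, x) \<notin> S" for t x
  proof (rule ccontr)
    assume "v t x \<noteq> 0"
    with that(1,2) have "(t, x) \<in> {(t, x). t \<in> {0..T} \<and> x \<in> closure \<Omega> \<and> v t x \<noteq> 0}" by simp
    with that(3) show False unfolding S_def by (meson closure_subset subsetD)
  qed
  have cont: "continuous_on ({0..T} \<times> UNIV) (\<lambda>(t, x). extend_zero \<Omega> (v t) x)"
  proof -
    have "continuous_on ({0..T} \<times> closure \<Omega>) (\<lambda>(t, x). extend_zero \<Omega> (v t) x)"
    proof (rule continuous_on_eq)
      show "continuous_on ({0..T} \<times> closure \<Omega>) (\<lambda>(t, x). v t x)"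
        using Ck unfolding clU[symmetric] by (simp add: eval_nat_numeral)
      show "(case z of (t, x) \<Rightarrow> v t x) = (case z of (t, x) \<Rightarrow> extend_zero \<Omega> (v t) x)"
        if "z \<in> {0..T} \<times> closure \<Omega>" for z
        using zero that S by (force simp: extend_zero_def)
    qed
    moreover have "continuous_on ({0..T} \<times> - \<Omega>) (\<lambda>(t, x). extend_zero \<Omega> (v t) x)"
      by (rule continuous_on_eq[of _ "\<lambda>_. 0"]) (auto simp: extend_zero_def)
    ultimately have "continuous_on ({0..T} \<times> closure \<Omega> \<union> {0..T} \<times> - \<Omega>) (\<lambda>(t, x). extend_zero \<Omega> (v t) x)"
      using assms(2) by (intro continuous_on_closed_Un closed_Times) auto
    moreover have "{0..T} \<times> closure \<Omega> \<union> {0..T} \<times> - \<Omega> = {0..T} \<times> UNIV"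
      using closure_subset[of \<Omega>] by auto
    ultimately show ?thesis by simp
  qed
  let ?I = "range (\<lambda>j. (0, axis j 1)) :: (real \<times> (real^3)) set"
  let ?W = "\<Union>j. range (\<lambda>s. s *\<^sub>R axis j 1) :: (real^3) set"
  have "\<exists>K. dbound ({0<..<T} \<times> UNIV) (\<Union>b\<in>?I. range (\<lambda>s. s *\<^sub>R b)) 4 K (extend_zero U (\<lambda>(t, x). v t x $ i))" for i
  proof (rule Ck_closure_imp_dbound[where S = S])
    show "open U" "bounded U" unfolding U_def using assms by (auto intro: open_Times bounded_Times)
    show "closed S" by (simp add: S_def)
    show "{0<..<T} \<times> UNIV \<inter> S \<subseteq> U" using S by (auto simp: U_def)
    show "?I \<subseteq> Basis" by (auto simp: Basis_prod_def axis_in_Basis_iff)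
    show "Ck_closure 4 U (\<lambda>(t, x). v t x $ i)"
      using Ck_closure_component[OF Ck, of i] by (simp add: case_prod_unfold)
    show "(case z of (t, x) \<Rightarrow> v t x $ i) = 0" if "z \<in> U - S" for z
      using that zero closure_subset[of \<Omega>] by (auto simp: U_def)
  qed auto
  then obtain K where K: "\<And>i. dbound ({0<..<T} \<times> UNIV) (\<Union>b\<in>?I. range (\<lambda>s. s *\<^sub>R b)) 4 (K i)
      (extend_zero U (\<lambda>(t, x). v t x $ i))" by metis
  have W: "(\<Union>b\<in>?I. range (\<lambda>s. s *\<^sub>R b)) = (\<lambda>w. (0, w)) ` ?W" by auto
  have "0 \<le> K i" for i using dbound_nonneg[OF K[of i]] assms(1) by (auto simp: times_eq_iff)
  then have K_le: "K i \<le> sum K UNIV" for i by (intro member_le_sum) auto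
  have inner: "ubound 4 (3 ^ 4 * sum K UNIV) (\<lambda>x. extend_zero \<Omega> (v t) x $ i)" if "t \<in> {0<..<T}" for t i
  proof (rule dbound_axis_imp_ubound, rule dbound_mono[OF _ K_le])
    have "(\<lambda>x. extend_zero U (\<lambda>(t, x). v t x $ i) (t, x)) = (\<lambda>x. extend_zero \<Omega> (v t) x $ i)"
      using that by (auto simp: extend_zero_def U_def)
    with dbound_slice[OF K[of i, unfolded W] that]
    show "dbound UNIV ?W 4 (K i) (\<lambda>x. extend_zero \<Omega> (v t) x $ i)" by metis
  qed
  have "ubound 4 (3 ^ 4 * sum K UNIV) (\<lambda>x. extend_zero \<Omega> (v t) x $ i)" if t: "t \<in> {0..T}" for t i
  proof -
    \<comment> \<open>The end times are reached by continuity in time; the bound passes to the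
      limit.\<close>
    have "t \<in> closure {0<..<T}" using assms(1) t by simp
    then obtain s where s: "\<And>n. s n \<in> {0<..<T}" "s \<longlonglongrightarrow> t"
      unfolding closure_sequential by auto
    show ?thesis
    proof (rule dbound_LIMSEQ)
      show "ubound 4 (3 ^ 4 * sum K UNIV) (\<lambda>x. extend_zero \<Omega> (v (s n)) x $ i)" for n
        by (rule inner[OF s(1)])
      fix x
      have "(\<lambda>n. (\<lambda>(t, x). extend_zero \<Omega> (v t) x) (s n, x)) \<longlonglongrightarrow> (\<lambda>(t, x). extend_zero \<Omega> (v t) x) (t, x)"
      proof (rule continuous_on_tendsto_compose[OF cont])
        show "(\<lambda>n. (s n, x)) \<longlonglongrightarrow> (t, x)" by (intro tendsto_intros s(2))
        show "\<forall>\<^sub>F n in sequentially. (s n, x) \<in> {0..T} \<times> UNIV"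
          using s(1) by (auto intro!: always_eventually less_imp_le)
      qed (use t in auto)
      then show "(\<lambda>n. extend_zero \<Omega> (v (s n)) x $ i) \<longlonglongrightarrow> extend_zero \<Omega> (v t) x $ i"
        by (auto intro: tendsto_vec_nth)
    qed
  qed
  with cont that show thesis by blast
qed

subsection \<open>Consistency of one step\<close>

text \<open>The deviation of the average from the centre value is a sum of second differences: the
  numerical diffusion of the scheme.\<close>

lemma stencil_avg_diff:
  "1 / 7 * (\<Sum>\<omega>\<in>stencil. G (x + h *\<^sub>R \<omega>)) - G x =
    (\<Sum>j\<in>UNIV. - (1 / 7) * sdiff (h *\<^sub>R axis j 1) (sdiff (- (h *\<^sub>R axis j 1)) G) x)"
  unfolding sum_stencil by (simp add: sdiff_def sum_3 algebra_simps)

lemma ubound_stencil_avg_diff: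
  assumes "ubound (k + 2) L G" "0 \<le> h"
  shows "ubound k (3 / 7 * L * h\<^sup>2) (\<lambda>x. 1 / 7 * (\<Sum>\<omega>\<in>stencil. G (x + h *\<^sub>R \<omega>)) - G x)"
proof -
  have G: "ubound (Suc (Suc k)) L G" using assms(1) by (simp del: dbound.simps)
  have "ubound k (\<bar>- (1 / 7)\<bar> * (L * h * h)) (\<lambda>x. - (1 / 7) * sdiff (h *\<^sub>R axis j 1) (sdiff (- (h *\<^sub>R axis j 1)) G) x)" for j
    using dbound_sdiff[OF dbound_sdiff[OF G, of "- (h *\<^sub>R axis j 1)"], of "h *\<^sub>R axis j 1"] assms(2)
    by (intro dbound_cmult) auto
  then have "ubound k (\<Sum>j\<in>(UNIV :: 3 set). \<bar>- (1 / 7)\<bar> * (L * h * h))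
      (\<lambda>x. \<Sum>j\<in>UNIV. - (1 / 7) * sdiff (h *\<^sub>R axis j 1) (sdiff (- (h *\<^sub>R axis j 1)) G) x)"
    by (intro dbound_sum) auto
  then show ?thesis
    unfolding stencil_avg_diff by (simp add: power2_eq_square mult.assoc)
qed

text \<open>A central difference is the mean of the quotients with increments \<open>h\<close> and
  \<open>- h\<close>. First order in \<open>h\<close> is enough for the rate aimed at and saves an
  order of regularity.\<close>

lemma ubound_central_diff_partial_deriv:
  assumes "ubound (k + 2) L G" "0 < h"
  shows "ubound k (2 * L * h) (\<lambda>x. central_diff h j G x - partial_deriv j G x)"
proof -
  have "ubound k (\<bar>1 / 2\<bar> * (2 * L * \<bar>h\<bar> + 2 * L * \<bar>- h\<bar>))
     (\<lambda>x. 1 / 2 * ((sdiff (h *\<^sub>R axis j 1) G x / h - partial_deriv j G x) +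
       (sdiff ((- h) *\<^sub>R axis j 1) G x / (- h) - partial_deriv j G x)))"
    using assms by (intro dbound_cmult dbound_add ubound_quotient_partial_deriv) auto
  moreover have "1 / 2 * ((sdiff (h *\<^sub>R axis j 1) G x / h - partial_deriv j G x) +
       (sdiff ((- h) *\<^sub>R axis j 1) G x / (- h) - partial_deriv j G x)) =
       central_diff h j G x - partial_deriv j G x" for x
    using assms(2) by (simp add: sdiff_def central_diff_def field_simps)
  moreover have "\<bar>1 / 2\<bar> * (2 * L * \<bar>h\<bar> + 2 * L * \<bar>- h\<bar>) = 2 * L * h"
    using assms(2) by simp
  ultimately show ?thesis by (simp only:)
qed

text \<open>In the Taylor expansion at \<open>x\<close> the terms linear in \<open>d\<close> cancel
  the transport term up to the defect of \<open>d\<close> against \<open>- \<tau> * u\<close>. All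
  regularity is asked of \<open>G\<close>, so with \<open>G\<close> a discrete solution this applies
  before anything is known about \<open>f\<close>.\<close>

lemma step_consistency:
  assumes "ubound 2 L G" "0 < h" "0 \<le> \<tau>" "\<And>j. \<bar>u j x\<bar> \<le> K"
  shows "\<bar>G (x + d) - step h \<tau> u G x\<bar> \<le>
    9 * L * (norm d)\<^sup>2 + L * (\<Sum>j\<in>UNIV. \<bar>d $ j + \<tau> * u j x\<bar>) + 6 * \<tau> * K * L * h + 3 / 7 * L * h\<^sup>2"
proof -
  have G: "ubound (0 + 2) L G" "ubound (Suc 1) L G"
    using assms(1) by (simp_all add: numeral_2_eq_2 del: dbound.simps)
  have "0 \<le> L" using dbound_nonneg[OF assms(1)] by simp
  have "0 \<le> K" using assms(4)[of 1] by linarith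
  have pd: "\<bar>partial_deriv j G x\<bar> \<le> L" for j
    using dbound_bound[OF ubound_partial_deriv[OF G(2)]] by simp
  have cd: "\<bar>central_diff h j G x - partial_deriv j G x\<bar> \<le> 2 * L * h" for j
    using dbound_bound[OF ubound_central_diff_partial_deriv[OF G(1) assms(2)]] by simp
  have avg: "\<bar>1 / 7 * (\<Sum>\<omega>\<in>stencil. G (x + h *\<^sub>R \<omega>)) - G x\<bar> \<le> 3 / 7 * L * h\<^sup>2"
    using dbound_bound[OF ubound_stencil_avg_diff[OF G(1)]] assms(2) by simp
  have terms: "\<bar>d $ j * partial_deriv j G x + \<tau> * u j x * central_diff h j G x\<bar>
      \<le> L * \<bar>d $ j + \<tau> * u j x\<bar> + \<tau> * K * (2 * L * h)" for j
  proof -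
    have "d $ j * partial_deriv j G x + \<tau> * u j x * central_diff h j G x =
      (d $ j + \<tau> * u j x) * partial_deriv j G x + \<tau> * u j x * (central_diff h j G x - partial_deriv j G x)"
      by (simp add: algebra_simps)
    also have "\<bar>\<dots>\<bar> \<le> \<bar>d $ j + \<tau> * u j x\<bar> * L + \<tau> * K * (2 * L * h)"
      using assms(3,4) pd cd \<open>0 \<le> K\<close>
      by (intro order_trans[OF abs_triangle_ineq] add_mono) (auto simp: abs_mult intro!: mult_mono)
    finally show ?thesis by (simp add: mult.commute)
  qed
  have "\<bar>\<Sum>j\<in>UNIV. d $ j * partial_deriv j G x + \<tau> * u j x * central_diff h j G x\<bar>
      \<le> (\<Sum>j\<in>UNIV. L * \<bar>d $ j + \<tau> * u j x\<bar> + \<tau> * K * (2 * L * h))"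
    by (rule order_trans[OF sum_abs sum_mono[OF terms]])
  also have "\<dots> = L * (\<Sum>j\<in>UNIV. \<bar>d $ j + \<tau> * u j x\<bar>) + 6 * \<tau> * K * L * h"
    by (simp add: sum.distrib sum_distrib_left)
  finally have "\<bar>\<Sum>j\<in>UNIV. d $ j * partial_deriv j G x + \<tau> * u j x * central_diff h j G x\<bar>
      \<le> L * (\<Sum>j\<in>UNIV. \<bar>d $ j + \<tau> * u j x\<bar>) + 6 * \<tau> * K * L * h" .
  moreover have "G (x + d) - step h \<tau> u G x =
     (G (x + d) - G x - (\<Sum>j\<in>UNIV. d $ j * partial_deriv j G x))
     + (\<Sum>j\<in>UNIV. d $ j * partial_deriv j G x + \<tau> * u j x * central_diff h j G x)
     - (1 / 7 * (\<Sum>\<omega>\<in>stencil. G (x + h *\<^sub>R \<omega>)) - G x)"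
    unfolding step_def by (simp add: sum.distrib sum_distrib_left mult.assoc)
  ultimately show ?thesis
    using avg taylor_ubound2[OF assms(1), of x d] by linarith
qed

subsection \<open>The flow\<close>

lemma vector_derivative_norm_bound:
  fixes y :: "real \<Rightarrow> 'a::real_normed_vector"
  assumes "\<And>r. r \<in> closed_segment s t \<Longrightarrow> (y has_vector_derivative y' r) (at r within closed_segment s t)"
    and "\<And>r. r \<in> closed_segment s t \<Longrightarrow> norm (y' r) \<le> B"
  shows "norm (y t - y s) \<le> B * \<bar>t - s\<bar>"
proof -
  have "norm (y t - y s) \<le> B * norm (t - s)"
  proof (rule differentiable_bound[where S = "closed_segment s t" and f' = "\<lambda>r h. h *\<^sub>R y' r"])
    show "(y has_derivative (\<lambda>h. h *\<^sub>R y' r)) (at r within closed_segment s t)"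
      if "r \<in> closed_segment s t" for r
      using assms(1)[OF that] by (simp add: has_vector_derivative_def)
    show "onorm (\<lambda>h. h *\<^sub>R y' r) \<le> B" if "r \<in> closed_segment s t" for r
    proof (rule onorm_le)
      show "norm (h *\<^sub>R y' r) \<le> B * norm h" for h
        using mult_right_mono[OF assms(2)[OF that] norm_ge_zero[of h]] by (simp add: mult.commute)
    qed
  qed auto
  then show ?thesis by simp
qed

text \<open>For the difference \<open>d\<close> of the two solutions the Lipschitz bound makes
  \<open>exp (2 * L * r) * (d r \<bullet> d r)\<close> nondecreasing. It is zero at
  \<open>s\<close>, hence also at 0.\<close>

lemma ode_unique_backward:
  fixes y z :: "real \<Rightarrow> 'a::real_inner"
  assumes "0 \<le> s" "s \<le> T"
    and y: "\<And>r. r \<in> {0..T} \<Longrightarrow> (y has_vector_derivative V r (y r)) (at r within {0..T})"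
    and z: "\<And>r. r \<in> {0..T} \<Longrightarrow> (z has_vector_derivative V r (z r)) (at r within {0..T})"
    and L: "\<And>r a b. r \<in> {0..T} \<Longrightarrow> norm (V r a - V r b) \<le> L * norm (a - b)"
    and "y s = z s"
  shows "y 0 = z 0"
proof (cases "s = 0")
  case False
  define d where "d r = y r - z r" for r
  define d' where "d' r = V r (y r) - V r (z r)" for r
  define E where "E r = exp (2 * L * r) * (d r \<bullet> d r)" for r
  have "(E has_derivative (\<lambda>x. x * (exp (2 * L * r) * (2 * L * (d r \<bullet> d r) + 2 * (d r \<bullet> d' r))))) (at r within {0..s})"
    if "r \<in> {0..s}" for r
  proof -
    have r: "r \<in> {0..T}" using that assms(2) by auto
    have "(d has_vector_derivative d' r) (at r within {0..T})"
      unfolding d_def[abs_def] d'_def by (intro has_vector_derivative_diff y z r)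
    then have "(d has_derivative (\<lambda>x. x *\<^sub>R d' r)) (at r within {0..s})"
      unfolding has_vector_derivative_def using assms(2) by (auto intro: has_derivative_subset)
    then show ?thesis
      unfolding E_def[abs_def]
      by (auto intro!: derivative_eq_intros simp: inner_commute algebra_simps)
  qed
  then obtain r where r: "r \<in> {0<..<s}"
    and "E s - E 0 = (s - 0) * (exp (2 * L * r) * (2 * L * (d r \<bullet> d r) + 2 * (d r \<bullet> d' r)))"
    using mvt_simple[of 0 s E "\<lambda>r x. x * (exp (2 * L * r) * (2 * L * (d r \<bullet> d r) + 2 * (d r \<bullet> d' r)))"]
      False assms(1) by (auto simp: less_le)
  moreover have "0 \<le> 2 * L * (d r \<bullet> d r) + 2 * (d r \<bullet> d' r)"
  proof -
    have "\<bar>d r \<bullet> d' r\<bar> \<le> norm (d r) * norm (d' r)" by (rule Cauchy_Schwarz_ineq2)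
    also have "\<dots> \<le> norm (d r) * (L * norm (d r))"
      unfolding d_def d'_def using r assms(2) by (intro mult_left_mono L) auto
    also have "\<dots> = L * (d r \<bullet> d r)" by (simp add: power2_norm_eq_inner[symmetric] power2_eq_square)
    finally show ?thesis by linarith
  qed
  then have "0 \<le> (s - 0) * (exp (2 * L * r) * (2 * L * (d r \<bullet> d r) + 2 * (d r \<bullet> d' r)))"
    using assms(1) by (intro mult_nonneg_nonneg) auto
  moreover have "E s = 0" using assms(6) by (simp add: E_def d_def)
  ultimately have "E 0 \<le> 0" by linarith
  then have "(y 0 - z 0) \<bullet> (y 0 - z 0) \<le> 0" by (simp add: E_def d_def)
  then show ?thesis by (metis eq_iff_diff_eq_0 inner_gt_zero_iff not_le)
qed (use assms(6) in simp)

text \<open>All that is retained of the data: \<open>v\<close> and \<open>f0\<close> stand for the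
  zero extensions, and their smoothness is expressed by difference bounds in space. In time
  \<open>v\<close> is only continuous.\<close>

locale transport =
  fixes T K K\<^sub>0 :: real
    and v :: "real \<Rightarrow> real^3 \<Rightarrow> real^3"
    and X :: "real \<Rightarrow> real \<Rightarrow> real^3 \<Rightarrow> real^3"
    and f0 :: "real^3 \<Rightarrow> real"
    and f :: "real \<Rightarrow> real^3 \<Rightarrow> real"
  assumes T: "0 < T"
    and v_ubound: "\<And>t i. t \<in> {0..T} \<Longrightarrow> ubound 4 K (\<lambda>x. v t x $ i)"
    and v_cont: "continuous_on ({0..T} \<times> UNIV) (\<lambda>(t, x). v t x)"
    and flow: "is_flow T v X"
    and f0_ubound: "ubound 4 K\<^sub>0 f0"
    and f_def: "\<And>t x. f t x = f0 (X 0 t x)"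
begin

lemma K_nonneg: "0 \<le> K"
  using dbound_nonneg[OF v_ubound[of 0]] T by simp

lemma v_bound: "t \<in> {0..T} \<Longrightarrow> \<bar>v t x $ i\<bar> \<le> K"
  using dbound_bound[OF v_ubound] by simp

lemma norm_v_bound: assumes "t \<in> {0..T}" shows "norm (v t x) \<le> 3 * K"
  using norm_le_l1_cart[of "v t x"] v_bound[OF assms, of x] sum_mono[of UNIV "\<lambda>i. \<bar>v t x $ i\<bar>" "\<lambda>_. K"]
  by simp

lemma v_Lipschitz: assumes "t \<in> {0..T}" shows "norm (v t y - v t x) \<le> 3 * K * norm (y - x)"
proof -
  have "ubound (Suc 3) K (\<lambda>x. v t x $ i)" for i
    using v_ubound[OF assms] by (simp add: eval_nat_numeral del: dbound.simps)
  from ubound_Lipschitz[OF this]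
  have "(\<Sum>i\<in>UNIV. \<bar>(v t y - v t x) $ i\<bar>) \<le> (\<Sum>i\<in>(UNIV :: 3 set). K * norm (y - x))"
    by (intro sum_mono) simp
  then show ?thesis
    using norm_le_l1_cart[of "v t y - v t x"] by simp
qed

lemma v_cont_time: "continuous_on {0..T} (\<lambda>t. v t x)"
proof -
  have "continuous_on {0..T} ((\<lambda>(t, x). v t x) \<circ> (\<lambda>t. (t, x)))"
    by (intro continuous_on_compose continuous_intros continuous_on_subset[OF v_cont]) auto
  then show ?thesis by (simp add: o_def)
qed

lemma flow_id: "t \<in> {0..T} \<Longrightarrow> X t t x = x"
  using flow by (simp add: is_flow_def)

lemma flow_deriv:
  "t \<in> {0..T} \<Longrightarrow> s \<in> {0..T} \<Longrightarrow>
    ((\<lambda>r. X r t x) has_vector_derivative v s (X s t x)) (at s within {0..T})"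
  using flow by (simp add: is_flow_def)

text \<open>The trajectories \<open>\<lambda>r. X r s (X s t x)\<close> and
  \<open>\<lambda>r. X r t x\<close> agree at time \<open>s\<close>.\<close>

lemma flow_semigroup:
  assumes "s \<in> {0..T}" "t \<in> {0..T}" shows "X 0 s (X s t x) = X 0 t x"
  by (rule ode_unique_backward[where V = v and L = "3 * K" and s = s and T = T])
    (use assms flow_deriv flow_id v_Lipschitz in auto)

lemma f_characteristic: "s \<in> {0..T} \<Longrightarrow> t \<in> {0..T} \<Longrightarrow> f t x = f s (X s t x)"
  by (simp add: f_def flow_semigroup)

lemma f_0: "f 0 = f0"
  using T by (auto simp: f_def flow_id)

lemma segment_subset: "s \<in> {0..T} \<Longrightarrow> t \<in> {0..T} \<Longrightarrow> closed_segment s t \<subseteq> {0..T}"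
  by (auto simp: closed_segment_eq_real_ivl split: if_splits)

lemma flow_displacement:
  assumes "s \<in> {0..T}" "t \<in> {0..T}" shows "norm (X s t x - x) \<le> 3 * K * \<bar>s - t\<bar>"
proof -
  have "norm (X s t x - X t t x) \<le> 3 * K * \<bar>s - t\<bar>"
    using segment_subset[OF assms(2,1)] assms
    by (intro vector_derivative_norm_bound[where y' = "\<lambda>r. v r (X r t x)"])
      (auto intro!: norm_v_bound has_vector_derivative_within_subset[OF flow_deriv])
  then show ?thesis using assms flow_id by simp
qed

lemma flow_expansion:
  assumes "0 \<le> s" "s \<le> t" "t \<le> T"
  shows "norm (X s t x - x + integral {s..t} (\<lambda>r. v r x)) \<le> 9 * K\<^sup>2 * (t - s)\<^sup>2"
proof -
  let ?y = "\<lambda>r. X r t x - integral {s..r} (\<lambda>q. v q x)"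
  have seg: "closed_segment s t = {s..t}" using assms by (simp add: closed_segment_eq_real_ivl)
  have "norm (?y t - ?y s) \<le> 9 * K\<^sup>2 * (t - s) * \<bar>t - s\<bar>"
  proof (rule vector_derivative_norm_bound[where y' = "\<lambda>r. v r (X r t x) - v r x"], unfold seg)
    fix r assume r: "r \<in> {s..t}"
    show "(?y has_vector_derivative v r (X r t x) - v r x) (at r within {s..t})"
      using r assms
      by (intro has_vector_derivative_diff integral_has_vector_derivative
          has_vector_derivative_within_subset[OF flow_deriv] continuous_on_subset[OF v_cont_time]) auto
    have "norm (v r (X r t x) - v r x) \<le> 3 * K * norm (X r t x - x)"
      using r assms by (intro v_Lipschitz) auto
    also have "\<dots> \<le> 3 * K * (3 * K * \<bar>r - t\<bar>)"
      using r assms K_nonneg by (intro mult_left_mono flow_displacement) auto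
    also have "\<dots> \<le> 3 * K * (3 * K * (t - s))"
      using r K_nonneg by (intro mult_left_mono) auto
    finally show "norm (v r (X r t x) - v r x) \<le> 9 * K\<^sup>2 * (t - s)" by (simp add: power2_eq_square)
  qed
  moreover have "?y t - ?y s = - (X s t x - x + integral {s..t} (\<lambda>r. v r x))"
    using flow_id[of t x] assms by simp
  ultimately show ?thesis
    using assms by (simp only: norm_minus_cancel) (simp add: power2_eq_square mult.assoc)
qed

end

subsection \<open>Cell and time averages\<close>

text \<open>Over a fixed box the average is an integral of shifts of \<open>\<phi>\<close>, the form
  to which \<open>dbound_integral\<close> applies. The half-open cell and the closed box differ by a
  null set.\<close>

lemma initial_avg_eq:
  assumes "0 < h"
  shows "initial_avg h \<phi> x = 1 / h ^ 3 * integral (cbox (\<chi> i. - (h / 2)) (\<chi> i. h / 2)) (\<lambda>y. \<phi> (x + y))"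
proof -
  let ?c = "(\<chi> i. h / 2) :: real^3"
  have mc: "(\<chi> i. - (h / 2)) = - ?c" by (simp add: vec_eq_iff)
  have sub: "cell h x \<subseteq> cbox (- ?c + x) (?c + x)"
    by (auto simp: cell_def mem_box_cart less_imp_le add.commute)
  have "box (- ?c + x) (?c + x) \<subseteq> cell h x"
    by (auto simp: cell_def mem_box_cart less_imp_le add.commute)
  then have "negligible (cbox (- ?c + x) (?c + x) - cell h x)"
    by (intro negligible_subset[OF negligible_frontier_interval]) auto
  then have "integral (cell h x) \<phi> = integral (cbox (- ?c + x) (?c + x)) \<phi>"
    using sub by (intro integral_spike_set) (auto intro: negligible_subset)
  also have "\<dots> = integral (cbox (- ?c) ?c) (\<phi> \<circ> (+) x)"
    by (rule integral_shift_cbox_plus[symmetric])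
  finally show ?thesis by (simp add: initial_avg_def o_def mc)
qed

lemma content_cell:
  assumes "0 < h" shows "measure lborel (cbox (\<chi> i. - (h / 2)) (\<chi> i. h / 2) :: (real^3) set) = h ^ 3"
proof -
  have "(0::real^3) \<in> cbox (\<chi> i. - (h / 2)) (\<chi> i. h / 2)"
    using assms by (simp add: mem_box_cart)
  then show ?thesis using content_cbox_cart[of "\<chi> i. - (h / 2)" "(\<chi> i. h / 2) :: real^3"] by auto
qed

lemma shift_integrable:
  fixes \<phi> :: "real^3 \<Rightarrow> real"
  assumes "continuous_on UNIV \<phi>" shows "(\<lambda>y. \<phi> (x + y)) integrable_on cbox a b"
  by (intro integrable_continuous continuous_on_compose2[OF assms] continuous_intros) auto

lemma ubound_initial_avg:
  assumes "ubound k K \<phi>" "continuous_on UNIV \<phi>" "0 < h"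
  shows "ubound k K (initial_avg h \<phi>)"
proof -
  let ?Q = "cbox (\<chi> i. - (h / 2)) (\<chi> i. h / 2) :: (real^3) set"
  have "ubound k (K * measure lborel ?Q) (\<lambda>x. integral ?Q (\<lambda>y. \<phi> (x + y)))"
    using assms dbound_nonneg[OF assms(1)] by (intro dbound_integral dbound_shift shift_integrable) auto
  from dbound_cmult[OF this, of "1 / h ^ 3"] show ?thesis
    unfolding content_cell[OF assms(3)] initial_avg_eq[OF assms(3), abs_def] using assms(3) by simp
qed

text \<open>The difference is the average of \<open>sdiff y \<phi>\<close> over the cell, where the
  norm of \<open>y\<close> is at most 3 * (h / 2).\<close>

lemma ubound_initial_avg_diff:
  assumes "ubound (Suc k) K \<phi>" "0 < h"
  shows "ubound k (3 / 2 * K * h) (\<lambda>x. initial_avg h \<phi> x - \<phi> x)"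
proof -
  let ?Q = "cbox (\<chi> i. - (h / 2)) (\<chi> i. h / 2) :: (real^3) set"
  have cont: "continuous_on UNIV \<phi>" by (rule ubound_continuous[OF assms(1)])
  have K: "0 \<le> K" using dbound_nonneg[OF assms(1)] by simp
  have int: "(\<lambda>y. sdiff y \<phi> x) integrable_on ?Q" for x
    unfolding sdiff_def by (intro integrable_diff shift_integrable cont integrable_const)
  have bd: "ubound k (3 / 2 * K * h) (sdiff y \<phi>)" if "y \<in> ?Q" for y
  proof (rule dbound_mono[OF dbound_sdiff[OF assms(1)]])
    have "norm y \<le> (\<Sum>i\<in>UNIV. \<bar>y $ i\<bar>)" by (rule norm_le_l1_cart)
    also have "\<dots> \<le> (\<Sum>i\<in>(UNIV :: 3 set). h / 2)"
    proof (rule sum_mono)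
      fix i
      have "- (h / 2) \<le> y $ i \<and> y $ i \<le> h / 2" using that by (simp add: mem_box_cart)
      then show "\<bar>y $ i\<bar> \<le> h / 2" by linarith
    qed
    finally have "K * norm y \<le> K * (3 / 2 * h)" using K by (intro mult_left_mono) auto
    then show "K * norm y \<le> 3 / 2 * K * h" by (simp add: algebra_simps)
  qed simp
  have "ubound k (3 / 2 * K * h * measure lborel ?Q) (\<lambda>x. integral ?Q (\<lambda>y. sdiff y \<phi> x))"
    using K assms(2) by (intro dbound_integral bd int) auto
  from dbound_cmult[OF this, of "1 / h ^ 3"]
  have "ubound k (3 / 2 * K * h) (\<lambda>x. 1 / h ^ 3 * integral ?Q (\<lambda>y. sdiff y \<phi> x))"
    unfolding content_cell[OF assms(2)] using assms(2) by simp
  moreover have "1 / h ^ 3 * integral ?Q (\<lambda>y. sdiff y \<phi> x) = initial_avg h \<phi> x - \<phi> x" for x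
  proof -
    have "integral ?Q (\<lambda>y. sdiff y \<phi> x) = integral ?Q (\<lambda>y. \<phi> (x + y)) - \<phi> x * h ^ 3"
      unfolding sdiff_def using content_cell[OF assms(2)]
      by (subst integral_diff[OF shift_integrable[OF cont] integrable_const]) simp
    then show ?thesis unfolding initial_avg_eq[OF assms(2)] using assms(2) by (simp add: field_simps)
  qed
  ultimately show ?thesis by simp
qed

lemma power_one_plus_le_exp:
  fixes a :: real assumes "0 \<le> a" shows "(1 + a) ^ n \<le> exp (a * real n)"
proof -
  have "(1 + a) ^ n \<le> exp a ^ n" using assms by (intro power_mono exp_ge_add_one_self) auto
  then show ?thesis by (simp add: exp_of_nat_mult[symmetric] mult.commute)
qed

subsection \<open>Spatial regularity of the solution\<close>

context transport
begin

section \<open>Discrete solutions on the whole space\<close>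

lemma v_integrable:
  assumes "0 \<le> a" "b \<le> T" shows "(\<lambda>s. v s x) integrable_on {a..b}"
  by (intro integrable_continuous_real continuous_on_subset[OF v_cont_time]) (use assms in auto)

lemma v_component_integrable:
  assumes "0 \<le> a" "b \<le> T" shows "(\<lambda>s. v s x $ j) integrable_on {a..b}"
  by (intro integrable_continuous_real continuous_intros continuous_on_subset[OF v_cont_time]) (use assms in auto)

text \<open>Multiplied by \<open>\<tau>\<close> this is a component of the integral in
  \<open>flow_expansion\<close>, so the displacement of one step is reproduced up to
  \<open>\<tau>\<^sup>2\<close>.\<close>

definition time_avg :: "real \<Rightarrow> nat \<Rightarrow> 3 \<Rightarrow> real^3 \<Rightarrow> real" where
  "time_avg \<tau> n j x = 1 / \<tau> * integral {\<tau> * real n..\<tau> * real (Suc n)} (\<lambda>s. v s x $ j)"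

lemma ubound_time_avg:
  assumes "0 < \<tau>" "\<tau> * real (Suc n) \<le> T"
  shows "ubound 4 K (time_avg \<tau> n j)"
proof -
  let ?J = "cbox (\<tau> * real n) (\<tau> * real (Suc n))"
  have "ubound 4 (K * measure lborel ?J) (\<lambda>x. integral ?J (\<lambda>s. v s x $ j))"
  proof (rule dbound_integral)
    show "ubound 4 K (\<lambda>x. v s x $ j)" if "s \<in> ?J" for s
    proof (rule v_ubound)
      have "0 \<le> \<tau> * real n" using assms(1) by simp
      with that assms(2) show "s \<in> {0..T}" by auto
    qed
  qed (use assms v_component_integrable K_nonneg in auto)
  moreover have "measure lborel ?J = \<tau>" using assms(1) by (simp add: algebra_simps)
  ultimately have "ubound 4 (\<bar>1 / \<tau>\<bar> * (K * \<tau>)) (\<lambda>x. 1 / \<tau> * integral ?J (\<lambda>s. v s x $ j))"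
    by (intro dbound_cmult) simp
  then show ?thesis using assms(1) by (simp add: time_avg_def[abs_def])
qed

text \<open>With mesh size \<open>h = (4 * K + 1) * \<tau>\<close> the CFL quantity is at most K /
  (8 K + 2), which is below 1 / 7; the summand 1 keeps the mesh positive when
  \<open>K = 0\<close>.\<close>

primrec aux_scheme :: "real \<Rightarrow> nat \<Rightarrow> real^3 \<Rightarrow> real" where
  "aux_scheme \<tau> 0 = f0"
| "aux_scheme \<tau> (Suc n) = step ((4 * K + 1) * \<tau>) \<tau> (time_avg \<tau> n) (aux_scheme \<tau> n)"

text \<open>The rate 48 is the growth factor 3 * 2^4 of \<open>dbound_step\<close> at order 4 under
  the velocity bound \<open>K\<close>.\<close>

definition L\<^sub>1 :: real where "L\<^sub>1 = K\<^sub>0 * exp (48 * K * T)"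

lemma K\<^sub>0_nonneg: "0 \<le> K\<^sub>0"
  using dbound_nonneg[OF f0_ubound] by simp

lemma L\<^sub>1_nonneg: "0 \<le> L\<^sub>1"
  using K\<^sub>0_nonneg by (simp add: L\<^sub>1_def)

lemma ubound_aux_scheme:
  assumes "0 < \<tau>" "\<tau> * real n \<le> T" shows "ubound 4 L\<^sub>1 (aux_scheme \<tau> n)"
proof -
  have "ubound 4 (K\<^sub>0 * (1 + 48 * K * \<tau>) ^ n) (aux_scheme \<tau> n)"
    using assms(2)
  proof (induction n)
    case 0
    then show ?case using f0_ubound by simp
  next
    case (Suc n)
    define h where "h = (4 * K + 1) * \<tau>"
    have h: "0 < h" using assms(1) K_nonneg by (simp add: h_def add_nonneg_pos)
    have cfl: "\<bar>\<tau> / (2 * h) * time_avg \<tau> n j x\<bar> \<le> 1 / 7" for j x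
    proof -
      have "\<bar>\<tau> / (2 * h) * time_avg \<tau> n j x\<bar> \<le> \<tau> / (2 * h) * K"
        unfolding abs_mult using dbound_bound[OF ubound_time_avg[OF assms(1) Suc.prems], of x j] assms(1) h
        by (intro mult_mono) auto
      also have "\<dots> = K / (2 * (4 * K + 1))" using assms(1) by (simp add: h_def)
      also have "\<dots> \<le> 1 / 7" using K_nonneg by (simp add: divide_simps)
      finally show ?thesis .
    qed
    have "ubound 4 (K\<^sub>0 * (1 + 48 * K * \<tau>) ^ n * (1 + 3 * 2 ^ 4 * K * \<tau>)) (aux_scheme \<tau> (Suc n))"
      unfolding aux_scheme.simps h_def[symmetric]
    proof (rule dbound_step[OF _ _ h])
      have "\<tau> * real n \<le> \<tau> * real (Suc n)" using assms(1) by (intro mult_left_mono) auto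
      then show "ubound 4 (K\<^sub>0 * (1 + 48 * K * \<tau>) ^ n) (aux_scheme \<tau> n)"
        using Suc by simp
      show "0 \<le> 1 / 7 + \<tau> / (2 * h) * time_avg \<tau> n j x" "0 \<le> 1 / 7 - \<tau> / (2 * h) * time_avg \<tau> n j x" for x j
        using cfl[of j x] by linarith+
    qed (use assms(1) K_nonneg K\<^sub>0_nonneg ubound_time_avg[OF assms(1) Suc.prems] in auto)
    then show ?case by (simp add: mult_ac)
  qed
  moreover have "K\<^sub>0 * (1 + 48 * K * \<tau>) ^ n \<le> L\<^sub>1"
    unfolding L\<^sub>1_def
  proof (rule mult_left_mono[OF order_trans[OF power_one_plus_le_exp]])
    have "48 * K * (\<tau> * real n) \<le> 48 * K * T"
      using assms(2) K_nonneg by (intro mult_left_mono) auto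
    then show "exp (48 * K * \<tau> * real n) \<le> exp (48 * K * T)" by (simp add: mult_ac)
  qed (use assms(1) K_nonneg K\<^sub>0_nonneg in auto)
  ultimately show ?thesis by (rule dbound_mono)
qed

text \<open>The four summands are those of \<open>step_consistency\<close>, each divided by
  \<open>\<tau>\<^sup>2\<close>, with displacement at most 3 K \<tau> and mesh (4 K + 1)
  \<tau>.\<close>

definition C\<^sub>1 :: real where
  "C\<^sub>1 = 9 * L\<^sub>1 * (9 * K\<^sup>2) + L\<^sub>1 * (27 * K\<^sup>2) + 6 * K * L\<^sub>1 * (4 * K + 1) + 3 / 7 * L\<^sub>1 * (4 * K + 1)\<^sup>2"

text \<open>The error at \<open>x\<close> is the error one step earlier at the foot
  \<open>x + d\<close> of the characteristic, plus one consistency error of the discrete solution.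
  The feet do not stay on a lattice, so the scheme and the induction range over all points of
  space.\<close>

lemma aux_scheme_error:
  assumes "0 < \<tau>" "\<tau> * real n \<le> T"
  shows "\<bar>f (\<tau> * real n) x - aux_scheme \<tau> n x\<bar> \<le> real n * (C\<^sub>1 * \<tau>\<^sup>2)"
  using assms(2)
proof (induction n arbitrary: x)
  case 0
  then show ?case by (simp add: f_0)
next
  case (Suc n)
  define h where "h = (4 * K + 1) * \<tau>"
  have h: "0 < h" using assms(1) K_nonneg by (simp add: h_def add_nonneg_pos)
  define s t where "s = \<tau> * real n" and "t = \<tau> * real (Suc n)"
  have st: "0 \<le> s" "s \<le> t" "t \<le> T" "t - s = \<tau>"
    using assms(1) Suc.prems by (auto simp: s_def t_def algebra_simps)
  define G where "G = aux_scheme \<tau> n"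
  have G: "ubound 2 L\<^sub>1 G"
    unfolding G_def using st by (intro dbound_le[OF ubound_aux_scheme[OF assms(1)]]) (auto simp: s_def)
  define d where "d = X s t x - x"
  have "norm d \<le> 3 * K * \<tau>"
    unfolding d_def using flow_displacement[of s t x] st by auto
  then have "(norm d)\<^sup>2 \<le> (3 * K * \<tau>)\<^sup>2" by (intro power_mono) auto
  then have d2: "9 * L\<^sub>1 * (norm d)\<^sup>2 \<le> 9 * L\<^sub>1 * (9 * K\<^sup>2 * \<tau>\<^sup>2)"
    using L\<^sub>1_nonneg by (intro mult_left_mono) (auto simp: power_mult_distrib)
  have "\<bar>d $ j + \<tau> * time_avg \<tau> n j x\<bar> \<le> 9 * K\<^sup>2 * \<tau>\<^sup>2" for j
  proof -
    have "\<tau> * time_avg \<tau> n j x = integral {s..t} (\<lambda>r. v r x) $ j"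
      using assms(1) st v_integrable[of s t x] by (simp add: time_avg_def s_def[symmetric] t_def[symmetric] del: of_nat_Suc)
    then have "\<bar>d $ j + \<tau> * time_avg \<tau> n j x\<bar> \<le> norm (X s t x - x + integral {s..t} (\<lambda>r. v r x))"
      using component_le_norm_cart[of "X s t x - x + integral {s..t} (\<lambda>r. v r x)" j] by (simp add: d_def)
    also have "\<dots> \<le> 9 * K\<^sup>2 * (t - s)\<^sup>2" using st by (intro flow_expansion) auto
    finally show ?thesis using st by simp
  qed
  then have "(\<Sum>j\<in>UNIV. \<bar>d $ j + \<tau> * time_avg \<tau> n j x\<bar>) \<le> (\<Sum>j\<in>(UNIV :: 3 set). 9 * K\<^sup>2 * \<tau>\<^sup>2)"
    by (intro sum_mono)
  then have d1: "L\<^sub>1 * (\<Sum>j\<in>UNIV. \<bar>d $ j + \<tau> * time_avg \<tau> n j x\<bar>) \<le> L\<^sub>1 * (27 * K\<^sup>2 * \<tau>\<^sup>2)"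
    using L\<^sub>1_nonneg by (intro mult_left_mono) auto
  have "\<bar>G (x + d) - step h \<tau> (time_avg \<tau> n) G x\<bar> \<le>
    9 * L\<^sub>1 * (norm d)\<^sup>2 + L\<^sub>1 * (\<Sum>j\<in>UNIV. \<bar>d $ j + \<tau> * time_avg \<tau> n j x\<bar>) + 6 * \<tau> * K * L\<^sub>1 * h + 3 / 7 * L\<^sub>1 * h\<^sup>2"
    using dbound_bound[OF ubound_time_avg[OF assms(1) Suc.prems]] assms(1)
    by (intro step_consistency[OF G h]) auto
  also have "\<dots> \<le> C\<^sub>1 * \<tau>\<^sup>2"
    using d1 d2 unfolding C\<^sub>1_def h_def by (simp add: algebra_simps power2_eq_square)
  finally have cons: "\<bar>G (x + d) - aux_scheme \<tau> (Suc n) x\<bar> \<le> C\<^sub>1 * \<tau>\<^sup>2"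
    by (simp add: h_def G_def)
  have "f t x = f s (x + d)" using f_characteristic[of s t x] st by (simp add: d_def)
  moreover have "\<bar>f s (x + d) - G (x + d)\<bar> \<le> real n * (C\<^sub>1 * \<tau>\<^sup>2)"
    using Suc.IH[of "x + d"] st by (simp add: G_def s_def)
  ultimately have "\<bar>f t x - aux_scheme \<tau> (Suc n) x\<bar> \<le> real n * (C\<^sub>1 * \<tau>\<^sup>2) + C\<^sub>1 * \<tau>\<^sup>2"
    using cons by linarith
  then show ?case by (simp add: t_def algebra_simps)
qed

text \<open>No smoothness of the flow enters: the solution is a pointwise limit of discrete solutions whose
  iterated differences are bounded uniformly in the mesh size.\<close>

lemma f_ubound:
  assumes t: "t \<in> {0..T}" shows "ubound 4 L\<^sub>1 (f t)"
proof (cases "t = 0")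
  case True
  have "K\<^sub>0 * 1 \<le> L\<^sub>1"
    unfolding L\<^sub>1_def using K\<^sub>0_nonneg K_nonneg T by (intro mult_left_mono) auto
  then show ?thesis using True f_0 dbound_mono[OF f0_ubound] by simp
next
  case False
  with t have "0 < t" "t \<le> T" by auto
  define \<tau> where "\<tau> n = t / real (Suc n)" for n
  have \<tau>: "0 < \<tau> n" "\<tau> n * real (Suc n) = t" for n using \<open>0 < t\<close> by (auto simp: \<tau>_def)
  show ?thesis
  proof (rule dbound_LIMSEQ)
    show "ubound 4 L\<^sub>1 (aux_scheme (\<tau> n) (Suc n))" for n
      by (rule ubound_aux_scheme) (use \<tau>[of n] \<open>t \<le> T\<close> in auto)
    fix x
    show "(\<lambda>n. aux_scheme (\<tau> n) (Suc n) x) \<longlonglongrightarrow> f t x"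
    proof (rule LIM_zero_cancel, rule Lim_null_comparison)
      show "\<forall>\<^sub>F n in sequentially. norm (aux_scheme (\<tau> n) (Suc n) x - f t x) \<le> C\<^sub>1 * t\<^sup>2 * inverse (real (Suc n))"
      proof (intro always_eventually allI)
        fix n
        have "\<bar>f t x - aux_scheme (\<tau> n) (Suc n) x\<bar> \<le> real (Suc n) * (C\<^sub>1 * (\<tau> n)\<^sup>2)"
          using aux_scheme_error[OF \<tau>(1)[of n], of "Suc n" x] \<tau>(2)[of n] \<open>t \<le> T\<close> by simp
        also have "\<dots> = C\<^sub>1 * t\<^sup>2 * inverse (real (Suc n))"
          by (simp add: \<tau>_def power2_eq_square field_simps del: of_nat_Suc)
        finally show "norm (aux_scheme (\<tau> n) (Suc n) x - f t x) \<le> C\<^sub>1 * t\<^sup>2 * inverse (real (Suc n))"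
          by (simp add: abs_minus_commute)
      qed
      show "(\<lambda>n. C\<^sub>1 * t\<^sup>2 * inverse (real (Suc n))) \<longlonglongrightarrow> 0"
        by (intro tendsto_mult_right_zero LIMSEQ_inverse_real_of_nat)
    qed
  qed
qed

end

subsection \<open>The transport equation\<close>

context transport
begin

lemma f_ubound':
  assumes "t \<in> {0..T}" "k \<le> 4" shows "ubound k L\<^sub>1 (f t)"
  by (rule dbound_le[OF f_ubound[OF assms(1)] assms(2)])

lemma v_ubound':
  assumes "t \<in> {0..T}" "k \<le> 4" shows "ubound k K (\<lambda>x. v t x $ j)"
  by (rule dbound_le[OF v_ubound[OF assms(1)] assms(2)])

lemma ubound_pd_f:
  assumes "t \<in> {0..T}" "k \<le> 3" "1 \<le> k" shows "ubound k L\<^sub>1 (partial_deriv j (f t))"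
  using assms by (intro ubound_partial_deriv f_ubound') auto

section \<open>Dependence on time\<close>

lemma f_time_Lipschitz:
  assumes "s \<in> {0..T}" "t \<in> {0..T}" shows "\<bar>f t x - f s x\<bar> \<le> L\<^sub>1 * (3 * K) * \<bar>t - s\<bar>"
proof -
  have "\<bar>f s (X s t x) - f s x\<bar> \<le> L\<^sub>1 * norm (X s t x - x)"
    by (rule ubound_Lipschitz[of 0]) (use f_ubound'[OF assms(1), of 1] in simp)
  also have "\<dots> \<le> L\<^sub>1 * (3 * K * \<bar>s - t\<bar>)"
    by (intro mult_left_mono flow_displacement assms L\<^sub>1_nonneg)
  finally show ?thesis
    by (simp add: f_characteristic[OF assms, symmetric] abs_minus_commute mult.assoc)
qed

lemma f_cont_time: "continuous_on {0..T} (\<lambda>t. f t x)"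
proof -
  have "(L\<^sub>1 * (3 * K))-lipschitz_on {0..T} (\<lambda>t. f t x)"
    using f_time_Lipschitz[of _ _ x] L\<^sub>1_nonneg K_nonneg
    by (intro lipschitz_onI) (auto simp: dist_real_def)
  then show ?thesis by (rule lipschitz_on_continuous_on)
qed

text \<open>The difference quotients are continuous in time and converge uniformly, because
  \<open>L\<^sub>1\<close> does not depend on \<open>t\<close>.\<close>

lemma pd_f_cont_time: "continuous_on {0..T} (\<lambda>t. partial_deriv j (f t) x)"
proof (rule uniform_limit_theorem)
  let ?r = "\<lambda>n. inverse (real (Suc n))"
  let ?q = "\<lambda>n t. sdiff (?r n *\<^sub>R axis j 1) (f t) x / ?r n"
  show "\<forall>\<^sub>F n in sequentially. continuous_on {0..T} (?q n)"
    unfolding sdiff_def by (intro always_eventually allI continuous_intros f_cont_time) auto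
  show "uniform_limit {0..T} ?q (\<lambda>t. partial_deriv j (f t) x) sequentially"
  proof (rule uniform_limitI)
    fix e :: real assume "0 < e"
    have "(\<lambda>n. 2 * L\<^sub>1 * ?r n) \<longlonglongrightarrow> 0"
      by (intro tendsto_mult_right_zero LIMSEQ_inverse_real_of_nat)
    then have "\<forall>\<^sub>F n in sequentially. 2 * L\<^sub>1 * ?r n < e"
      using \<open>0 < e\<close> by (rule order_tendstoD)
    then show "\<forall>\<^sub>F n in sequentially. \<forall>t\<in>{0..T}. dist (?q n t) (partial_deriv j (f t) x) < e"
    proof (rule eventually_mono, intro ballI)
      fix n t assume n: "2 * L\<^sub>1 * ?r n < e" and t: "t \<in> {0..T}"
      have "ubound (0 + 2) L\<^sub>1 (f t)" using f_ubound'[OF t, of 2] by (simp add: numeral_2_eq_2 del: dbound.simps)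
      from dbound_bound[OF ubound_quotient_partial_deriv[OF this, of "?r n" j], of x]
      show "dist (?q n t) (partial_deriv j (f t) x) < e" using n by (simp add: dist_real_def)
    qed
  qed
qed simp

text \<open>Here the starting time \<open>r\<close> varies, whereas \<open>is_flow\<close> provides
  derivatives in the first argument only. Between \<open>r\<close> and \<open>s\<close> the
  trajectory started at \<open>x\<close> stays close to \<open>x\<close>, so its velocity is within
  \<open>e\<close> of \<open>v s x\<close>; integrating from \<open>r\<close> to \<open>s\<close>
  explains the sign.\<close>

lemma flow_derivative_base_point:
  assumes s: "s \<in> {0..T}" and "0 < e"
  shows "\<forall>\<^sub>F r in at s within {0..T}. norm (X s r x - x + (r - s) *\<^sub>R v s x) \<le> e * \<bar>r - s\<bar>"
proof -
  have "((\<lambda>q. v q x) \<longlongrightarrow> v s x) (at s within {0..T})"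
    using v_cont_time s by (simp add: continuous_on_def)
  then obtain \<delta> where \<delta>: "0 < \<delta>" "\<And>q. q \<in> {0..T} \<Longrightarrow> \<bar>q - s\<bar> < \<delta> \<Longrightarrow> norm (v q x - v s x) < e / 2"
    using \<open>0 < e\<close> unfolding Lim_within
    by (smt (verit, best) dist_norm dist_real_def half_gt_zero norm_zero right_minus_eq)
  \<comment> \<open>One half of \<open>e\<close> is for the variation of \<open>v\<close> in time,
    the other for the drift of the trajectory away from \<open>x\<close>.\<close>
  define \<eta> where "\<eta> = min \<delta> (e / (2 * (9 * K\<^sup>2 + 1)))"
  have K2: "0 < 9 * K\<^sup>2 + 1" by (simp add: add_nonneg_pos)
  have \<eta>: "0 < \<eta>" using \<delta>(1) \<open>0 < e\<close> K2 by (simp add: \<eta>_def)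
  have "norm (X s r x - x + (r - s) *\<^sub>R v s x) \<le> e * \<bar>r - s\<bar>"
    if r: "r \<in> {0..T}" "\<bar>r - s\<bar> < \<eta>" for r
  proof -
    let ?y = "\<lambda>q. X q r x - q *\<^sub>R v s x"
    have "norm (?y s - ?y r) \<le> e * \<bar>s - r\<bar>"
    proof (rule vector_derivative_norm_bound[where y' = "\<lambda>q. v q (X q r x) - v s x"])
      fix q assume q: "q \<in> closed_segment r s"
      then have qT: "q \<in> {0..T}" using segment_subset[OF r(1) s] by auto
      have qr: "\<bar>q - r\<bar> \<le> \<bar>r - s\<bar>" "\<bar>q - s\<bar> \<le> \<bar>r - s\<bar>"
        using q by (auto simp: closed_segment_eq_real_ivl split: if_splits)
      show "(?y has_vector_derivative v q (X q r x) - v s x) (at q within closed_segment r s)"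
        using segment_subset[OF r(1) s] q
        by (intro has_vector_derivative_diff has_vector_derivative_within_subset[OF flow_deriv[OF r(1) qT]])
          (auto intro!: derivative_eq_intros)
      have "norm (v q (X q r x) - v q x) \<le> 3 * K * norm (X q r x - x)" by (rule v_Lipschitz[OF qT])
      also have "\<dots> \<le> 3 * K * (3 * K * \<bar>q - r\<bar>)"
        using K_nonneg by (intro mult_left_mono flow_displacement qT r) auto
      also have "\<dots> = 9 * K\<^sup>2 * \<bar>q - r\<bar>" by (simp add: power2_eq_square)
      also have "\<dots> \<le> (9 * K\<^sup>2 + 1) * \<eta>"
        using qr(1) r(2) by (intro mult_mono) auto
      also have "\<dots> \<le> e / 2"
      proof -
        have "(9 * K\<^sup>2 + 1) * \<eta> \<le> (9 * K\<^sup>2 + 1) * (e / (2 * (9 * K\<^sup>2 + 1)))"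
          using K2 by (intro mult_left_mono) (auto simp: \<eta>_def)
        also have "\<dots> = e / 2" using K2 by (simp add: field_simps)
        finally show ?thesis .
      qed
      finally have "norm (v q (X q r x) - v q x) \<le> e / 2" .
      moreover have "norm (v q x - v s x) < e / 2"
        using qr(2) r(2) by (intro \<delta>(2) qT) (simp add: \<eta>_def)
      ultimately show "norm (v q (X q r x) - v s x) \<le> e"
        using norm_triangle_ineq[of "v q (X q r x) - v q x" "v q x - v s x"] by simp
    qed
    moreover have "?y s - ?y r = X s r x - x + (r - s) *\<^sub>R v s x"
      using flow_id[OF r(1)] by (simp add: algebra_simps)
    ultimately show ?thesis by (simp add: abs_minus_commute)
  qed
  then show ?thesis
    using \<eta> unfolding eventually_at by (intro exI[of _ \<eta>]) (auto simp: dist_real_def)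
qed

text \<open>Writing \<open>f r x = f s (X s r x)\<close> moves the dependence on \<open>r\<close>
  into the foot point. \<open>f s\<close> is differentiable by its Taylor bound, and the chain rule
  needs the foot only at \<open>r = s\<close>.\<close>

lemma f_time_derivative:
  assumes s: "s \<in> {0..T}"
  shows "((\<lambda>r. f r x) has_vector_derivative - (\<Sum>j\<in>UNIV. v s x $ j * partial_deriv j (f s) x)) (at s within {0..T})"
proof -
  let ?D = "\<lambda>w. \<Sum>j\<in>UNIV. w $ j * partial_deriv j (f s) x"
  let ?P = "\<lambda>r. X s r x"
  have X: "(?P has_derivative (\<lambda>a. a *\<^sub>R (- v s x))) (at s within {0..T})"
    unfolding has_derivative_within_alt2
  proof (intro conjI allI impI bounded_linear_scaleR_left)
    fix e :: real assume "0 < e"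
    then show "\<forall>\<^sub>F r in at s within {0..T}.
        norm (X s r x - X s s x - (r - s) *\<^sub>R (- v s x)) \<le> e * norm (r - s)"
      using flow_derivative_base_point[OF s, of e x] flow_id[OF s] by simp
  qed
  have "(f s has_derivative ?D) (at x)"
    unfolding has_derivative_within_alt2
  proof (intro conjI allI impI)
    show "bounded_linear ?D"
      by (intro bounded_linear_sum bounded_linear_mult_const bounded_linear_vec_nth)
    fix e :: real assume "0 < e"
    define \<eta> where "\<eta> = e / (9 * L\<^sub>1 + 1)"
    have L: "0 < 9 * L\<^sub>1 + 1" using L\<^sub>1_nonneg by simp
    have "norm (f s y - f s x - ?D (y - x)) \<le> e * norm (y - x)" if "norm (y - x) < \<eta>" for y
    proof -
      have "\<bar>f s (x + (y - x)) - f s x - ?D (y - x)\<bar> \<le> 9 * L\<^sub>1 * (norm (y - x))\<^sup>2"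
        by (rule taylor_ubound2[OF f_ubound'[OF s]]) simp
      also have "\<dots> = 9 * L\<^sub>1 * norm (y - x) * norm (y - x)" by (simp add: power2_eq_square)
      also have "\<dots> \<le> (9 * L\<^sub>1 + 1) * \<eta> * norm (y - x)"
        using that L\<^sub>1_nonneg by (intro mult_right_mono mult_mono) auto
      also have "(9 * L\<^sub>1 + 1) * \<eta> = e" using L by (simp add: \<eta>_def)
      finally show ?thesis by simp
    qed
    moreover have "0 < \<eta>" using L \<open>0 < e\<close> by (simp add: \<eta>_def)
    ultimately show "\<forall>\<^sub>F y in at x. norm (f s y - f s x - ?D (y - x)) \<le> e * norm (y - x)"
      unfolding eventually_at by (auto simp: dist_norm)
  qed
  then have "(f s has_derivative ?D) (at (X s s x))" using flow_id[OF s] by simp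
  from has_derivative_compose[OF X this]
  have "((\<lambda>r. f s (X s r x)) has_derivative (\<lambda>a. ?D (a *\<^sub>R (- v s x)))) (at s within {0..T})" .
  moreover have "(\<lambda>a. ?D (a *\<^sub>R (- v s x))) = (\<lambda>a. a *\<^sub>R - (\<Sum>j\<in>UNIV. v s x $ j * partial_deriv j (f s) x))"
    by (auto simp: sum_distrib_left sum_negf mult.assoc)
  ultimately have "((\<lambda>r. f s (X s r x)) has_vector_derivative
      - (\<Sum>j\<in>UNIV. v s x $ j * partial_deriv j (f s) x)) (at s within {0..T})"
    by (simp add: has_vector_derivative_def)
  then show ?thesis
    by (rule has_vector_derivative_transform[OF s, rotated]) (simp add: f_characteristic[OF s])
qed

lemma transport_integrable:
  assumes "0 \<le> s" "t \<le> T"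
  shows "(\<lambda>r. \<Sum>j\<in>UNIV. v r x $ j * partial_deriv j (f r) x) integrable_on {s..t}"
  using assms
  by (intro integrable_continuous_real continuous_intros continuous_on_subset[OF v_cont_time]
      continuous_on_subset[OF pd_f_cont_time]) auto

lemma f_time_integral:
  assumes "0 \<le> s" "s \<le> t" "t \<le> T"
  shows "f t x - f s x = - integral {s..t} (\<lambda>r. \<Sum>j\<in>UNIV. v r x $ j * partial_deriv j (f r) x)"
proof -
  have "((\<lambda>r. - (\<Sum>j\<in>UNIV. v r x $ j * partial_deriv j (f r) x)) has_integral f t x - f s x) {s..t}"
  proof (rule fundamental_theorem_of_calculus[OF assms(2)])
    fix r assume r: "r \<in> {s..t}"
    show "((\<lambda>r. f r x) has_vector_derivative - (\<Sum>j\<in>UNIV. v r x $ j * partial_deriv j (f r) x)) (at r within {s..t})"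
      by (rule has_vector_derivative_within_subset[OF f_time_derivative]) (use r assms in auto)
  qed
  from integral_unique[OF this] show ?thesis
    unfolding integral_neg by (rule sym)
qed

text \<open>The gradient under the time integral leaves three of the four orders; 24 is three
  directions times the Leibniz factor 2^3.\<close>

lemma ubound_f_time_diff:
  assumes "0 \<le> s" "s \<le> t" "t \<le> T"
  shows "ubound 3 (24 * K * L\<^sub>1 * (t - s)) (\<lambda>x. f t x - f s x)"
proof -
  have "ubound 3 (24 * K * L\<^sub>1 * measure lborel (cbox s t))
      (\<lambda>x. integral (cbox s t) (\<lambda>r. \<Sum>j\<in>UNIV. v r x $ j * partial_deriv j (f r) x))"
  proof (rule dbound_integral)
    fix r assume "r \<in> cbox s t"
    then have r: "r \<in> {0..T}" using assms by auto
    have "ubound 3 (\<Sum>j\<in>(UNIV :: 3 set). 2 ^ 3 * K * L\<^sub>1) (\<lambda>x. \<Sum>j\<in>UNIV. v r x $ j * partial_deriv j (f r) x)"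
      using K_nonneg L\<^sub>1_nonneg
      by (intro dbound_sum dbound_mult v_ubound' ubound_pd_f r) auto
    then show "ubound 3 (24 * K * L\<^sub>1) (\<lambda>x. \<Sum>j\<in>UNIV. v r x $ j * partial_deriv j (f r) x)"
      by (simp add: mult.assoc)
  qed (use assms transport_integrable K_nonneg L\<^sub>1_nonneg in auto)
  from dbound_minus[OF this] show ?thesis
    unfolding f_time_integral[OF assms] using assms by simp
qed

subsection \<open>The residual of the exact solution\<close>

lemma initial_avg_v_cont_time:
  assumes "0 < h" shows "continuous_on {0..T} (\<lambda>s. initial_avg h (\<lambda>y. v s y $ j) x)"
proof -
  let ?Q = "cbox (\<chi> i. - (h / 2)) (\<chi> i. h / 2) :: (real^3) set"
  have "continuous_on ({0..T} \<times> ?Q) (\<lambda>(s, y). v s (x + y) $ j)"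
  proof -
    have "continuous_on ({0..T} \<times> ?Q) (\<lambda>z. (\<lambda>(s, y). v s y) (fst z, x + snd z) $ j)"
      by (intro continuous_intros continuous_on_compose2[OF v_cont]) auto
    then show ?thesis by (simp add: case_prod_unfold)
  qed
  from integral_continuous_on_param[OF this] show ?thesis
    unfolding initial_avg_eq[OF assms] by (intro continuous_intros)
qed

text \<open>\<open>velocity_avg\<close> is the time average of the cell averages
  \<open>initial_avg\<close> of a component of \<open>v\<close>, and neither averaging enlarges a
  bound.\<close>

lemma ubound_velocity_avg:
  assumes "0 < h" "0 < \<tau>" "\<tau> * real (Suc n) \<le> T"
  shows "ubound 4 K (velocity_avg h \<tau> v n j)"
proof -
  let ?J = "cbox (\<tau> * real n) (\<tau> * real (Suc n))"
  have J: "?J \<subseteq> {0..T}"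
  proof -
    have "0 \<le> \<tau> * real n" using assms(2) by simp
    then show ?thesis using assms(3) by auto
  qed
  have "ubound 4 (K * measure lborel ?J) (\<lambda>x. integral ?J (\<lambda>s. initial_avg h (\<lambda>y. v s y $ j) x))"
  proof (rule dbound_integral)
    fix s assume "s \<in> ?J"
    then have s: "s \<in> {0..T}" using J by auto
    have "continuous_on UNIV (\<lambda>y. v s y $ j)"
      by (rule ubound_continuous[of 0]) (use v_ubound'[OF s, of 1] in simp)
    then show "ubound 4 K (initial_avg h (\<lambda>y. v s y $ j))"
      by (rule ubound_initial_avg[OF v_ubound[OF s] _ assms(1)])
  next
    show "(\<lambda>s. initial_avg h (\<lambda>y. v s y $ j) x) integrable_on ?J" for x
      using continuous_on_subset[OF initial_avg_v_cont_time[OF assms(1)] J] by (rule integrable_continuous)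
  qed (rule K_nonneg)
  moreover have "measure lborel ?J = \<tau>" using assms(2) by (simp add: algebra_simps)
  ultimately have "ubound 4 (\<bar>1 / \<tau>\<bar> * (K * \<tau>)) (\<lambda>x. 1 / \<tau> * integral ?J (\<lambda>s. initial_avg h (\<lambda>y. v s y $ j) x))"
    by (intro dbound_cmult) simp
  moreover have "(\<lambda>x. 1 / \<tau> * integral ?J (\<lambda>s. initial_avg h (\<lambda>y. v s y $ j) x)) = velocity_avg h \<tau> v n j"
    by (auto simp: velocity_avg_def initial_avg_def fun_eq_iff)
  ultimately show ?thesis using assms(2) by simp
qed

text \<open>In order: central difference against derivative, time lag within a step, cell average of
  the velocity, numerical diffusion. Each 12 is three directions times the Leibniz factor
  2^2.\<close>

definition C\<^sub>2 :: real where
  "C\<^sub>2 = 12 * (2 * K * L\<^sub>1) + 12 * (24 * K\<^sup>2 * L\<^sub>1) + 12 * (3 / 2 * K * L\<^sub>1) + 3 / 7 * L\<^sub>1"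

lemma C\<^sub>2_nonneg: "0 \<le> C\<^sub>2"
  using K_nonneg L\<^sub>1_nonneg by (simp add: C\<^sub>2_def)

text \<open>The change of \<open>f\<close> over a step is an integral of the transport term, and so
  is \<open>\<tau>\<close> times the discrete transport term; they are compared under the same time
  integral. Two orders remain on either route: \<open>f s\<close> loses two to the central
  difference, while the time difference of \<open>f\<close> has order three and loses one to its
  gradient.\<close>

lemma ubound_residual:
  assumes "0 < h" "0 < \<tau>" "\<tau> * real (Suc n) \<le> T"
  defines "s \<equiv> \<tau> * real n" and "t \<equiv> \<tau> * real (Suc n)"
  shows "ubound 2 (C\<^sub>2 * (\<tau> * (\<tau> + h) + h\<^sup>2)) (\<lambda>x. f t x - step h \<tau> (velocity_avg h \<tau> v n) (f s) x)"
proof -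
  have st: "0 \<le> s" "s \<le> t" "t \<le> T" "t - s = \<tau>"
    using assms by (auto simp: s_def t_def algebra_simps)
  have sT: "s \<in> {0..T}" using st by auto
  let ?a = "\<lambda>j r x. initial_avg h (\<lambda>y. v r y $ j) x"
  let ?I = "\<lambda>r x. \<Sum>j\<in>UNIV. ?a j r x * central_diff h j (f s) x - v r x $ j * partial_deriv j (f r) x"
  have a_int: "(\<lambda>r. ?a j r x) integrable_on {s..t}" for j x
    using st by (intro integrable_continuous_real continuous_on_subset[OF initial_avg_v_cont_time[OF assms(1)]]) auto
  have F4: "ubound (2 + 2) L\<^sub>1 (f s)" using f_ubound[OF sT] by simp
  have pds: "ubound 2 L\<^sub>1 (partial_deriv j (f r))" if "r \<in> {0..T}" for r j
    using that by (intro ubound_pd_f) auto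
  have I: "ubound 2 (12 * (2 * K * L\<^sub>1) * h + 12 * (24 * K\<^sup>2 * L\<^sub>1) * \<tau> + 12 * (3 / 2 * K * L\<^sub>1) * h) (?I r)"
    if "r \<in> {s..t}" for r
  proof -
    have r: "r \<in> {0..T}" using that st by auto
    have "continuous_on UNIV (\<lambda>y. v r y $ j)" for j
      by (rule ubound_continuous[of 0]) (use v_ubound'[OF r, of 1] in simp)
    then have a: "ubound 2 K (?a j r)" for j
      using ubound_initial_avg[OF v_ubound'[OF r] _ assms(1), of 2] by simp
    have av: "ubound 2 (3 / 2 * K * h) (\<lambda>x. ?a j r x - v r x $ j)" for j
      using ubound_initial_avg_diff[OF v_ubound'[OF r, of "Suc 2"] assms(1)] by simp
    have dd: "ubound 2 (24 * K * L\<^sub>1 * \<tau>) (\<lambda>x. partial_deriv j (f s) x - partial_deriv j (f r) x)" for j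
    proof -
      have "24 * K * L\<^sub>1 * (r - s) \<le> 24 * K * L\<^sub>1 * \<tau>"
        using that st K_nonneg L\<^sub>1_nonneg by (intro mult_left_mono) auto
      with ubound_f_time_diff[of s r] have "ubound 3 (24 * K * L\<^sub>1 * \<tau>) (\<lambda>x. f r x - f s x)"
        using that st by (auto intro: dbound_mono simp del: dbound.simps)
      from dbound_minus[OF this] have "ubound (Suc 2) (24 * K * L\<^sub>1 * \<tau>) (\<lambda>x. f s x - f r x)"
        by (simp add: eval_nat_numeral del: dbound.simps)
      from ubound_partial_deriv[OF this, of j] show ?thesis
        using ext[of "partial_deriv j (\<lambda>x. f s x - f r x)", OF partial_deriv_diff[OF f_ubound'[OF sT, of 2] f_ubound'[OF r, of 2]]]
        by (simp del: dbound.simps)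
    qed
    have cd: "ubound 2 (2 * L\<^sub>1 * h) (\<lambda>x. central_diff h j (f s) x - partial_deriv j (f s) x)" for j
      by (rule ubound_central_diff_partial_deriv[OF F4 assms(1)])
    \<comment> \<open>Telescoping sum: first the central difference is replaced by the derivative,
      then time \<open>s\<close> by \<open>r\<close>, then the averaged velocity by
      \<open>v\<close>.\<close>
    have "ubound 2 (2 ^ 2 * K * (2 * L\<^sub>1 * h) + 2 ^ 2 * K * (24 * K * L\<^sub>1 * \<tau>) + 2 ^ 2 * (3 / 2 * K * h) * L\<^sub>1)
      (\<lambda>x. ?a j r x * (central_diff h j (f s) x - partial_deriv j (f s) x)
        + ?a j r x * (partial_deriv j (f s) x - partial_deriv j (f r) x)
        + (?a j r x - v r x $ j) * partial_deriv j (f r) x)" for j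
      using K_nonneg L\<^sub>1_nonneg assms(1,2)
      by (intro dbound_add dbound_mult a av dd cd pds[OF r]) auto
    then have "ubound 2 (\<Sum>j\<in>(UNIV :: 3 set). 2 ^ 2 * K * (2 * L\<^sub>1 * h) + 2 ^ 2 * K * (24 * K * L\<^sub>1 * \<tau>) + 2 ^ 2 * (3 / 2 * K * h) * L\<^sub>1)
      (\<lambda>x. \<Sum>j\<in>UNIV. ?a j r x * (central_diff h j (f s) x - partial_deriv j (f s) x)
        + ?a j r x * (partial_deriv j (f s) x - partial_deriv j (f r) x)
        + (?a j r x - v r x $ j) * partial_deriv j (f r) x)"
      by (intro dbound_sum) auto
    moreover have "?a j r x * (central_diff h j (f s) x - partial_deriv j (f s) x)
        + ?a j r x * (partial_deriv j (f s) x - partial_deriv j (f r) x)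
        + (?a j r x - v r x $ j) * partial_deriv j (f r) x =
        ?a j r x * central_diff h j (f s) x - v r x $ j * partial_deriv j (f r) x" for j x
      by (simp add: algebra_simps)
    ultimately show ?thesis by (simp add: power2_eq_square algebra_simps)
  qed
  have I_int: "?I r x = (\<Sum>j\<in>UNIV. ?a j r x * central_diff h j (f s) x) - (\<Sum>j\<in>UNIV. v r x $ j * partial_deriv j (f r) x)" for r x
    by (rule sum_subtractf)
  have a_sum: "((\<lambda>r. \<Sum>j\<in>UNIV. ?a j r x * central_diff h j (f s) x) has_integral
      \<tau> * (\<Sum>j\<in>UNIV. velocity_avg h \<tau> v n j x * central_diff h j (f s) x)) {s..t}" for x
  proof -
    have "\<tau> * velocity_avg h \<tau> v n j x = integral {s..t} (\<lambda>r. ?a j r x)" for j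
      using assms(2) by (simp add: velocity_avg_def initial_avg_def s_def t_def)
    then have "((\<lambda>r. ?a j r x * central_diff h j (f s) x) has_integral
        \<tau> * velocity_avg h \<tau> v n j x * central_diff h j (f s) x) {s..t}" for j
      using has_integral_mult_left[OF integrable_integral[OF a_int]] by simp
    then have "((\<lambda>r. \<Sum>j\<in>UNIV. ?a j r x * central_diff h j (f s) x) has_integral
        (\<Sum>j\<in>UNIV. \<tau> * velocity_avg h \<tau> v n j x * central_diff h j (f s) x)) {s..t}"
      by (intro has_integral_sum) auto
    then show ?thesis by (simp add: sum_distrib_left mult.assoc)
  qed
  have "ubound 2 ((12 * (2 * K * L\<^sub>1) * h + 12 * (24 * K\<^sup>2 * L\<^sub>1) * \<tau> + 12 * (3 / 2 * K * L\<^sub>1) * h) * measure lborel (cbox s t))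
    (\<lambda>x. integral (cbox s t) (\<lambda>r. ?I r x))"
  proof (rule dbound_integral)
    show "(\<lambda>r. ?I r x) integrable_on cbox s t" for x
      unfolding I_int using a_sum transport_integrable st
      by (intro integrable_diff) (auto intro: has_integral_integrable)
  qed (use I K_nonneg L\<^sub>1_nonneg assms(1,2) in auto)
  from dbound_diff[OF this ubound_stencil_avg_diff[OF F4, of h]]
  have "ubound 2 ((12 * (2 * K * L\<^sub>1) * h + 12 * (24 * K\<^sup>2 * L\<^sub>1) * \<tau> + 12 * (3 / 2 * K * L\<^sub>1) * h) * \<tau> + 3 / 7 * L\<^sub>1 * h\<^sup>2)
    (\<lambda>x. integral (cbox s t) (\<lambda>r. ?I r x) - (1 / 7 * (\<Sum>\<omega>\<in>stencil. f s (x + h *\<^sub>R \<omega>)) - f s x))"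
    using assms(1) st by simp
  moreover have "integral (cbox s t) (\<lambda>r. ?I r x) - (1 / 7 * (\<Sum>\<omega>\<in>stencil. f s (x + h *\<^sub>R \<omega>)) - f s x)
      = f t x - step h \<tau> (velocity_avg h \<tau> v n) (f s) x" for x
  proof -
    have "integral {s..t} (\<lambda>r. ?I r x) = \<tau> * (\<Sum>j\<in>UNIV. velocity_avg h \<tau> v n j x * central_diff h j (f s) x) + (f t x - f s x)"
      unfolding I_int f_time_integral[OF st(1-3)] using transport_integrable st(1,3)
      by (subst integral_diff[OF has_integral_integrable[OF a_sum]]) (auto simp: integral_unique[OF a_sum])
    then show ?thesis by (simp add: step_def)
  qed
  ultimately have "ubound 2 ((12 * (2 * K * L\<^sub>1) * h + 12 * (24 * K\<^sup>2 * L\<^sub>1) * \<tau> + 12 * (3 / 2 * K * L\<^sub>1) * h) * \<tau> + 3 / 7 * L\<^sub>1 * h\<^sup>2)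
    (\<lambda>x. f t x - step h \<tau> (velocity_avg h \<tau> v n) (f s) x)" by simp
  moreover have "(12 * (2 * K * L\<^sub>1) * h + 12 * (24 * K\<^sup>2 * L\<^sub>1) * \<tau> + 12 * (3 / 2 * K * L\<^sub>1) * h) * \<tau> + 3 / 7 * L\<^sub>1 * h\<^sup>2
      \<le> C\<^sub>2 * (\<tau> * (\<tau> + h) + h\<^sup>2)"
  proof -
    have "(a * h + b * \<tau> + c * h) * \<tau> + d * h\<^sup>2 \<le> (a + b + c + d) * (\<tau> * (\<tau> + h) + h\<^sup>2)"
      if "0 \<le> a" "0 \<le> b" "0 \<le> c" "0 \<le> d" for a b c d :: real
    proof -
      have "0 \<le> (a + c) * (\<tau> * \<tau> + h * h) + b * (\<tau> * h + h * h) + d * (\<tau> * \<tau> + \<tau> * h)"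
        using that assms(1,2) by simp
      then show ?thesis by (simp add: algebra_simps power2_eq_square)
    qed
    from this[of "12 * (2 * K * L\<^sub>1)" "12 * (24 * K\<^sup>2 * L\<^sub>1)" "12 * (3 / 2 * K * L\<^sub>1)" "3 / 7 * L\<^sub>1"]
    show ?thesis unfolding C\<^sub>2_def by this (use K_nonneg L\<^sub>1_nonneg in auto)
  qed
  ultimately show ?thesis by (rule dbound_mono)
qed

end

subsection \<open>Error estimates\<close>

lemma shift_closed_grid: "shift_closed (grid h) (grid_steps h)"
proof -
  have "\<exists>m::int. (x + w) $ i = h * of_int m"
    if x: "\<forall>i. \<exists>m::int. x $ i = h * of_int m" and w: "w \<in> grid_steps h" for x w :: "real^3" and i
  proof -
    obtain m :: int where m: "x $ i = h * of_int m" using x by blast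
    obtain p :: int where "w $ i = h * of_int p"
    proof -
      obtain j where "w = h *\<^sub>R axis j 1 \<or> w = - (h *\<^sub>R axis j 1)"
        using w by (auto simp: grid_steps_def)
      then have "w $ i = h * of_int 1 \<or> w $ i = h * of_int (- 1) \<or> w $ i = h * of_int 0"
        by (cases "i = j") (auto simp: axis_def)
      then show thesis using that by blast
    qed
    with m have "(x + w) $ i = h * of_int (m + p)" by (simp add: distrib_left)
    then show ?thesis by blast
  qed
  then show ?thesis unfolding shift_closed_def grid_def by blast
qed

text \<open>Backward quotients become quotients with increment \<open>- h\<close>, which
  \<open>ubound_quotient_partial_deriv\<close> covers as well.\<close>

lemma bwd_fwd_diff_eq:
  "bwd_diff h j (fwd_diff h i \<phi>) x = sdiff (- (h *\<^sub>R axis j 1)) (\<lambda>y. sdiff (h *\<^sub>R axis i 1) \<phi> y / h) x / (- h)"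
  by (cases "h = 0") (auto simp: bwd_diff_def fwd_diff_def sdiff_def divide_simps)

context transport
begin

text \<open>The residual bound of one step per unit of time, that is, divided by
  \<open>\<tau>\<close>.\<close>

definition consistency_error :: "real \<Rightarrow> real \<Rightarrow> real" where
  "consistency_error h \<tau> = C\<^sub>2 * (\<tau> + h + h\<^sup>2 / \<tau>)"

text \<open>The initial averaging error and the residuals accumulated up to time \<open>T\<close>,
  amplified by the growth rate 3 * 2^2 * K of second differences.\<close>

definition error_bound :: "real \<Rightarrow> real \<Rightarrow> real" where
  "error_bound h \<tau> = exp (12 * K * T) * (3 / 2 * K\<^sub>0 * h + T * consistency_error h \<tau>)"

lemma explicit_scheme_step:
  assumes "explicit_scheme h \<tau> N v f0 g" "0 < \<tau>" "n < N" "x \<in> grid h"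
  shows "g (Suc n) x = step h \<tau> (velocity_avg h \<tau> v n) (g n) x"
proof -
  let ?A = "1 / 7 * (\<Sum>\<omega>\<in>stencil. g n (x + h *\<^sub>R \<omega>))"
    and ?B = "\<Sum>j\<in>UNIV. velocity_avg h \<tau> v n j x * central_diff h j (g n) x"
  have "(g (Suc n) x - ?A) * (1 / \<tau>) + ?B = 0"
    using assms unfolding explicit_scheme_def by auto
  then have "g (Suc n) x = ?A - \<tau> * ?B" using assms(2) by (simp add: field_simps)
  then show ?thesis by (simp add: step_def)
qed

text \<open>By linearity the error obeys the scheme with the residual of \<open>f\<close> as source.
  Stability is applied on the grid, the only place where scheme and CFL condition are available; the
  residual bound is restricted to it from the whole space.\<close>

lemma dbound_error:
  assumes "0 < h" "0 < \<tau>" "\<tau> * real N \<le> T" "CFL h \<tau> N v" "explicit_scheme h \<tau> N v f0 g" "n \<le> N"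
  shows "dbound (grid h) (grid_steps h) 2 (error_bound h \<tau>) (\<lambda>x. g n x - f (\<tau> * real n) x)"
proof -
  let ?E = "\<lambda>n. (1 + 12 * K * \<tau>) ^ n * (3 / 2 * K\<^sub>0 * h + real n * (\<tau> * consistency_error h \<tau>))"
  have ce: "0 \<le> consistency_error h \<tau>"
    using C\<^sub>2_nonneg assms(1,2) by (simp add: consistency_error_def)
  have E_nonneg: "0 \<le> ?E n" for n
    using ce K_nonneg K\<^sub>0_nonneg assms(1,2) by simp
  have "dbound (grid h) (grid_steps h) 2 (?E n) (\<lambda>x. g n x - f (\<tau> * real n) x)"
    using assms(6)
  proof (induction n)
    case 0
    have "ubound 2 (3 / 2 * K\<^sub>0 * h) (\<lambda>x. initial_avg h f0 x - f0 x)"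
      by (rule ubound_initial_avg_diff[OF dbound_le[OF f0_ubound] assms(1)]) simp
    then have "dbound (grid h) (grid_steps h) 2 (3 / 2 * K\<^sub>0 * h) (\<lambda>x. initial_avg h f0 x - f0 x)"
      by (rule dbound_subset) auto
    then have "dbound (grid h) (grid_steps h) 2 (3 / 2 * K\<^sub>0 * h) (\<lambda>x. g 0 x - f 0 x)"
      by (rule dbound_cong[OF shift_closed_grid]) (use assms(5) in \<open>simp add: explicit_scheme_def f_0\<close>)
    then show ?case by simp
  next
    case (Suc n)
    let ?u = "velocity_avg h \<tau> v n" and ?s = "\<tau> * real n" and ?t = "\<tau> * real (Suc n)"
    have n: "\<tau> * real (Suc n) \<le> T"
      using Suc.prems assms(2,3) by (meson less_imp_le mult_left_mono of_nat_mono order_trans)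
    have "dbound (grid h) (grid_steps h) 2 (?E n * (1 + 3 * 2 ^ 2 * K * \<tau>)) (step h \<tau> ?u (\<lambda>x. g n x - f ?s x))"
    proof (rule dbound_step[OF shift_closed_grid subset_refl assms(1)])
      show "dbound (grid h) (grid_steps h) 2 K (?u j)" for j
        by (rule dbound_subset[OF dbound_le[OF ubound_velocity_avg[OF assms(1,2) n]]]) auto
      show "0 \<le> 1 / 7 + \<tau> / (2 * h) * ?u j x" "0 \<le> 1 / 7 - \<tau> / (2 * h) * ?u j x" if "x \<in> grid h" for x j
        using assms(4) Suc.prems that by (auto simp: CFL_def)
    qed (use assms(2) K_nonneg E_nonneg Suc in auto)
    moreover have "dbound (grid h) (grid_steps h) 2 (C\<^sub>2 * (\<tau> * (\<tau> + h) + h\<^sup>2)) (\<lambda>x. f ?t x - step h \<tau> ?u (f ?s) x)"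
      by (rule dbound_subset[OF ubound_residual[OF assms(1,2) n]]) auto
    ultimately have "dbound (grid h) (grid_steps h) 2 (?E n * (1 + 3 * 2 ^ 2 * K * \<tau>) + C\<^sub>2 * (\<tau> * (\<tau> + h) + h\<^sup>2))
      (\<lambda>x. step h \<tau> ?u (\<lambda>x. g n x - f ?s x) x - (f ?t x - step h \<tau> ?u (f ?s) x))"
      by (rule dbound_diff)
    then have "dbound (grid h) (grid_steps h) 2 (?E n * (1 + 3 * 2 ^ 2 * K * \<tau>) + C\<^sub>2 * (\<tau> * (\<tau> + h) + h\<^sup>2))
      (\<lambda>x. g (Suc n) x - f ?t x)"
    proof (rule dbound_cong[OF shift_closed_grid])
      fix x assume "x \<in> grid h"
      from explicit_scheme_step[OF assms(5,2) _ this] Suc.prems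
      show "step h \<tau> ?u (\<lambda>x. g n x - f ?s x) x - (f ?t x - step h \<tau> ?u (f ?s) x) = g (Suc n) x - f ?t x"
        unfolding step_diff[symmetric] by simp
    qed
    \<comment> \<open>The new source is enlarged by a power of a factor that is at least 1, so that
      \<open>?E\<close> keeps its closed form.\<close>
    moreover have "?E n * (1 + 3 * 2 ^ 2 * K * \<tau>) + C\<^sub>2 * (\<tau> * (\<tau> + h) + h\<^sup>2) \<le> ?E (Suc n)"
    proof -
      have "C\<^sub>2 * (\<tau> * (\<tau> + h) + h\<^sup>2) = 1 * (\<tau> * consistency_error h \<tau>)"
        using assms(2) by (simp add: consistency_error_def field_simps power2_eq_square)
      also have "\<dots> \<le> (1 + 12 * K * \<tau>) ^ Suc n * (\<tau> * consistency_error h \<tau>)"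
        using K_nonneg ce assms(2) by (intro mult_right_mono one_le_power) auto
      finally have "C\<^sub>2 * (\<tau> * (\<tau> + h) + h\<^sup>2) \<le> (1 + 12 * K * \<tau>) ^ Suc n * (\<tau> * consistency_error h \<tau>)" .
      moreover have "q ^ n * (b + real n * y) * q + q ^ Suc n * y = q ^ Suc n * (b + real (Suc n) * y)" for q b y :: real
        by (simp add: algebra_simps)
      moreover have "1 + 3 * 2 ^ 2 * K * \<tau> = 1 + 12 * K * \<tau>" by simp
      ultimately show ?thesis by (metis add_left_mono)
    qed
    ultimately show ?case by (rule dbound_mono)
  qed
  moreover have "?E n \<le> error_bound h \<tau>"
    unfolding error_bound_def
  proof (rule mult_mono)
    have nT: "\<tau> * real n \<le> T"
      using assms(2,3,6) by (meson less_imp_le mult_left_mono of_nat_mono order_trans)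
    have "(1 + 12 * K * \<tau>) ^ n \<le> exp (12 * K * \<tau> * real n)"
      using K_nonneg assms(2) by (intro power_one_plus_le_exp) auto
    also have "12 * K * \<tau> * real n \<le> 12 * K * T"
      using mult_left_mono[OF nT, of "12 * K"] K_nonneg by (simp add: mult.assoc)
    finally show "(1 + 12 * K * \<tau>) ^ n \<le> exp (12 * K * T)" by simp
    show "3 / 2 * K\<^sub>0 * h + real n * (\<tau> * consistency_error h \<tau>) \<le> 3 / 2 * K\<^sub>0 * h + T * consistency_error h \<tau>"
      using mult_right_mono[OF nT ce] by (simp add: algebra_simps)
  qed (use ce K\<^sub>0_nonneg assms(1,2) in auto)
  ultimately show ?thesis by (rule dbound_mono)
qed

text \<open>The lower bound on \<open>\<tau>\<close> controls \<open>h\<^sup>2 / \<tau>\<close> by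
  \<open>h powr \<alpha> / c\<close>. The upper bound gives
  \<open>\<tau> \<le> C * h powr \<alpha>\<close>, because 2 - \<alpha> is at least \<alpha> and
  \<open>h < 1\<close>.\<close>

lemma error_bound_le:
  assumes "0 < \<alpha>" "\<alpha> \<le> 1" "0 < c" "0 < h" "h < 1" "0 < \<tau>"
    and "c * h powr (2 - \<alpha>) \<le> \<tau>" "\<tau> \<le> C * h powr (2 - \<alpha>)" "0 \<le> C"
  shows "error_bound h \<tau> \<le> exp (12 * K * T) * (3 / 2 * K\<^sub>0 + T * (C\<^sub>2 * (C + 1 + 1 / c))) * h powr \<alpha>"
proof -
  have h: "h \<le> h powr \<alpha>" using powr_mono'[of \<alpha> 1 h] assms by simp
  have "h powr (2 - \<alpha>) \<le> h powr \<alpha>" using assms by (intro powr_mono') auto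
  then have "C * h powr (2 - \<alpha>) \<le> C * h powr \<alpha>" using assms(9) by (rule mult_left_mono)
  then have \<tau>: "\<tau> \<le> C * h powr \<alpha>" using assms(8) by linarith
  have "c * h\<^sup>2 = c * h powr (2 - \<alpha>) * h powr \<alpha>"
    using assms(4) by (simp add: mult.assoc powr_add[symmetric])
  also have "\<dots> \<le> \<tau> * h powr \<alpha>" using assms(7) by (intro mult_right_mono) auto
  finally have "h\<^sup>2 / \<tau> \<le> 1 / c * h powr \<alpha>" using assms(3,6) by (simp add: field_simps)
  with h \<tau> have "\<tau> + h + h\<^sup>2 / \<tau> \<le> (C + 1 + 1 / c) * h powr \<alpha>" by (simp add: algebra_simps)
  then have "T * (C\<^sub>2 * (\<tau> + h + h\<^sup>2 / \<tau>)) \<le> T * (C\<^sub>2 * ((C + 1 + 1 / c) * h powr \<alpha>))"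
    using C\<^sub>2_nonneg T by (intro mult_left_mono) auto
  moreover have "3 / 2 * K\<^sub>0 * h \<le> 3 / 2 * K\<^sub>0 * h powr \<alpha>"
    using h K\<^sub>0_nonneg by (intro mult_left_mono) auto
  ultimately have "3 / 2 * K\<^sub>0 * h + T * consistency_error h \<tau>
      \<le> (3 / 2 * K\<^sub>0 + T * (C\<^sub>2 * (C + 1 + 1 / c))) * h powr \<alpha>"
    by (simp add: consistency_error_def algebra_simps)
  then show ?thesis unfolding error_bound_def by (simp add: mult.assoc)
qed

text \<open>With increments of length \<open>h\<close>, \<open>dbound_error\<close> bounds the
  difference quotients of the error. Every quotient of \<open>f\<close> replaced by a derivative
  adds 2 \<open>L\<^sub>1\<close> h, which happens once in the second claim and twice in the
  third.\<close>

lemma scheme_error: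
  assumes "0 < h" "0 < \<tau>" "\<tau> * real N \<le> T" "CFL h \<tau> N v" "explicit_scheme h \<tau> N v f0 g"
    and "n \<le> N" "x \<in> grid h"
  shows "\<bar>g n x - f (\<tau> * real n) x\<bar> \<le> error_bound h \<tau>"
    and "\<bar>fwd_diff h i (g n) x - partial_deriv i (f (\<tau> * real n)) x\<bar> \<le> error_bound h \<tau> + 2 * L\<^sub>1 * h"
    and "\<bar>bwd_diff h j (fwd_diff h i (g n)) x - partial_deriv j (partial_deriv i (f (\<tau> * real n))) x\<bar>
      \<le> error_bound h \<tau> + 4 * L\<^sub>1 * h"
proof -
  let ?F = "f (\<tau> * real n)" and ?E = "error_bound h \<tau>"
  let ?p = "h *\<^sub>R axis i 1 :: real^3" and ?m = "- (h *\<^sub>R axis j 1) :: real^3"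
  define e where "e x = g n x - ?F x" for x
  have "\<tau> * real n \<le> T"
    using assms(2,3,6) by (meson less_imp_le mult_left_mono of_nat_mono order_trans)
  then have t: "\<tau> * real n \<in> {0..T}" using assms(2) by simp
  have e: "dbound (grid h) (grid_steps h) (Suc (Suc 0)) ?E e"
    using dbound_error[OF assms(1-6)] by (simp add: e_def[abs_def] numeral_2_eq_2 del: dbound.simps)
  have st: "?p \<in> grid_steps h" "?m \<in> grid_steps h" by (auto simp: grid_steps_def)
  have e1: "\<bar>sdiff ?p e x / h\<bar> \<le> ?E"
    using dbound_bound[OF dbound_sdiff[OF e st(1)] assms(7)] assms(1) by (simp add: field_simps)
  have e2: "\<bar>sdiff ?m (sdiff ?p e) x / (h * h)\<bar> \<le> ?E"
    using dbound_bound[OF dbound_sdiff[OF dbound_sdiff[OF e st(1)] st(2)] assms(7)] assms(1)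
    by (simp add: field_simps)
  \<comment> \<open>\<open>D\<close> inherits two orders from \<open>f\<close>, so its own backward
    quotient is still O(h): the inner quotient is replaced first (\<open>D2\<close>), then the outer
    one (\<open>D3\<close>).\<close>
  define D where "D x = sdiff ?p ?F x / h - partial_deriv i ?F x" for x
  have "ubound (2 + 2) L\<^sub>1 ?F" using f_ubound[OF t] by simp
  from ubound_quotient_partial_deriv[OF this, of h i]
  have D: "ubound (Suc 1) (2 * L\<^sub>1 * h) D"
    using assms(1) by (simp add: D_def[abs_def] numeral_2_eq_2 del: dbound.simps)
  have D1: "\<bar>D x\<bar> \<le> 2 * L\<^sub>1 * h" using dbound_bound[OF D] by simp
  have D2: "\<bar>sdiff ?m D x / (- h)\<bar> \<le> 2 * L\<^sub>1 * h"
    using dbound_bound[OF dbound_sdiff[OF D, of ?m], of x] assms(1) by (simp add: field_simps)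
  have "ubound (0 + 2) L\<^sub>1 (partial_deriv i ?F)"
    using ubound_pd_f[OF t, of 2 i] by (simp add: numeral_2_eq_2 del: dbound.simps)
  from dbound_bound[OF ubound_quotient_partial_deriv[OF this, of "- h" j], of x]
  have D3: "\<bar>sdiff ?m (partial_deriv i ?F) x / (- h) - partial_deriv j (partial_deriv i ?F) x\<bar> \<le> 2 * L\<^sub>1 * h"
    using assms(1) by simp
  show "\<bar>g n x - ?F x\<bar> \<le> ?E"
    using dbound_bound[OF e assms(7)] by (simp add: e_def)
  have "fwd_diff h i (g n) x - partial_deriv i ?F x = sdiff ?p e x / h + D x"
    using assms(1) by (simp add: fwd_diff_def D_def e_def sdiff_def diff_divide_distrib)
  then show "\<bar>fwd_diff h i (g n) x - partial_deriv i ?F x\<bar> \<le> ?E + 2 * L\<^sub>1 * h"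
    using e1 D1 by linarith
  have "bwd_diff h j (fwd_diff h i (g n)) x - partial_deriv j (partial_deriv i ?F) x =
      - (sdiff ?m (sdiff ?p e) x / (h * h)) + sdiff ?m D x / (- h)
      + (sdiff ?m (partial_deriv i ?F) x / (- h) - partial_deriv j (partial_deriv i ?F) x)"
    using assms(1) unfolding bwd_fwd_diff_eq by (simp add: D_def e_def sdiff_def field_simps)
  then show "\<bar>bwd_diff h j (fwd_diff h i (g n)) x - partial_deriv j (partial_deriv i ?F) x\<bar> \<le> ?E + 4 * L\<^sub>1 * h"
    using e2 D2 D3 by linarith
qed

end

theorem mainTheorem7:
  fixes T \<alpha> c C :: real
    and \<Omega> :: "(real^3) set"
    and v vbar :: "real \<Rightarrow> real^3 \<Rightarrow> real^3"
    and f0 f0bar :: "real^3 \<Rightarrow> real"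
    and X :: "real \<Rightarrow> real \<Rightarrow> real^3 \<Rightarrow> real^3"
    and f :: "real \<Rightarrow> real^3 \<Rightarrow> real"
  assumes "T > 0"
    and "open \<Omega>" and "connected \<Omega>" and "bounded \<Omega>"
    and "admissible_velocity T \<Omega> v"
    and "admissible_initial \<Omega> f0"
    and "\<And>t. vbar t = extend_zero \<Omega> (v t)"
    and "f0bar = extend_zero \<Omega> f0"
    and "is_flow T vbar X"
    and "\<And>t x. f t x = f0bar (X 0 t x)"
    and "0 < \<alpha>" and "\<alpha> \<le> 1"
    and "0 < c" and "c \<le> C"
  shows "\<exists>M>0. \<exists>\<delta>>0. \<forall>h \<tau>. \<forall>N::nat. \<forall>g :: nat \<Rightarrow> real^3 \<Rightarrow> real.
    0 < h \<and> h < \<delta> \<and> 0 < \<tau> \<and> \<tau> < \<delta> \<and>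
    c * h powr (2 - \<alpha>) \<le> \<tau> \<and> \<tau> \<le> C * h powr (2 - \<alpha>) \<and>
    T \<in> {\<tau> * real N ..< \<tau> * real N + \<tau>} \<and>
    CFL h \<tau> N vbar \<and>
    explicit_scheme h \<tau> N vbar f0bar g \<longrightarrow>
    (\<forall>n\<le>N. \<forall>i j. \<forall>x\<in>grid h.
       \<bar>g n x - f (real n * \<tau>) x\<bar> \<le> M * h powr \<alpha> \<and>
       \<bar>fwd_diff h i (g n) x - partial_deriv i (f (real n * \<tau>)) x\<bar> \<le> M * h powr \<alpha> \<and>
       \<bar>bwd_diff h j (fwd_diff h i (g n)) x
          - partial_deriv j (partial_deriv i (f (real n * \<tau>))) x\<bar> \<le> M * h powr \<alpha>)"
proof -
  obtain K where "\<And>t i. t \<in> {0..T} \<Longrightarrow> ubound 4 K (\<lambda>x. vbar t x $ i)"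
    and "continuous_on ({0..T} \<times> UNIV) (\<lambda>(t, x). vbar t x)"
    using velocity_regularity[OF assms(1,2,4,5)] unfolding assms(7) by metis
  moreover obtain K\<^sub>0 where "ubound 4 K\<^sub>0 f0bar"
    using initial_ubound[OF assms(2,4,6)] unfolding assms(8) by metis
  ultimately interpret transport T K K\<^sub>0 vbar X f0bar f
    using assms(1,9,10) by unfold_locales auto
  define M\<^sub>0 where "M\<^sub>0 = exp (12 * K * T) * (3 / 2 * K\<^sub>0 + T * (C\<^sub>2 * (C + 1 + 1 / c)))"
  \<comment> \<open>\<open>4 * L\<^sub>1\<close> absorbs the worst quotient replacement in
    \<open>scheme_error\<close>, and 1 makes \<open>M\<close> positive even for trivial
    data.\<close>
  define M where "M = M\<^sub>0 + 4 * L\<^sub>1 + 1"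
  have "0 \<le> M\<^sub>0"
    using assms(1,13,14) K\<^sub>0_nonneg C\<^sub>2_nonneg by (simp add: M\<^sub>0_def)
  then have "0 < M" using L\<^sub>1_nonneg by (simp add: M_def)
  moreover have "\<bar>g n x - f (real n * \<tau>) x\<bar> \<le> M * h powr \<alpha> \<and>
       \<bar>fwd_diff h i (g n) x - partial_deriv i (f (real n * \<tau>)) x\<bar> \<le> M * h powr \<alpha> \<and>
       \<bar>bwd_diff h j (fwd_diff h i (g n)) x
          - partial_deriv j (partial_deriv i (f (real n * \<tau>))) x\<bar> \<le> M * h powr \<alpha>"
    if h: "0 < h" "h < 1" and \<tau>: "0 < \<tau>" "c * h powr (2 - \<alpha>) \<le> \<tau>" "\<tau> \<le> C * h powr (2 - \<alpha>)"
      and N: "\<tau> * real N \<le> T" and scheme: "CFL h \<tau> N vbar" "explicit_scheme h \<tau> N vbar f0bar g"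
      and n: "n \<le> N" "x \<in> grid h" for h \<tau> N g n i j x
  proof -
    have E: "error_bound h \<tau> \<le> M\<^sub>0 * h powr \<alpha>"
      unfolding M\<^sub>0_def using assms(11-14) h \<tau> by (intro error_bound_le) auto
    have "h \<le> h powr \<alpha>" using powr_mono'[of \<alpha> 1 h] assms(11,12) h by simp
    then have "4 * L\<^sub>1 * h \<le> 4 * L\<^sub>1 * h powr \<alpha>" using L\<^sub>1_nonneg by (intro mult_left_mono) auto
    moreover have "M * h powr \<alpha> = M\<^sub>0 * h powr \<alpha> + 4 * L\<^sub>1 * h powr \<alpha> + h powr \<alpha>"
      by (simp add: M_def algebra_simps)
    moreover have "0 \<le> h powr \<alpha>" by simp
    ultimately have "error_bound h \<tau> + 4 * L\<^sub>1 * h \<le> M * h powr \<alpha>"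
      using E by linarith
    moreover have "0 \<le> L\<^sub>1 * h" using L\<^sub>1_nonneg h by simp
    ultimately show ?thesis
      using scheme_error(1)[OF h(1) \<tau>(1) N scheme n] scheme_error(2)[OF h(1) \<tau>(1) N scheme n, of i]
        scheme_error(3)[OF h(1) \<tau>(1) N scheme n, of j i]
      by (simp add: mult.commute[of "real n"])
  qed
  ultimately show ?thesis
    by (intro exI[of _ M] conjI exI[of _ 1]) auto
qed

end
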